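(* Let $\mathbb{F}$ be a field of characteristic zero, and let $r\ge 2$, $1\le i\le r$, $J\ge 0$ be integers, and $\ell=r-i+1$. Then $$\mathcal{A}_{(r-1)J+\ell}(q)=\mathrm{HP}^{J+1}_{i}$$ as formal power series in $q$.
   Context: Series $\mathcal{A}_n(q)$: for $1\le n\le r$, $\mathcal{A}_n(q)=\prod_{m\ge 1,\ m\not\equiv 0,\pm(r-n+1)\ (\mathrm{mod}\ 2r+1)}\frac{1}{1-q^m}$. For $g\ge 1$, recursively: $\mathcal{A}_{(r-1)g+1}(q)=\mathcal{A}_{(r-1)(g-1)+r}(q)$, and for $2\le n\le r$, $\mathcal{A}_{(r-1)g+n}(q)=\dfrac{\mathcal{A}_{(r-1)(g-1)+r-n+1}(q)-\mathcal{A}_{(r-1)(g-1)+r-n+2}(q)}{q^{g(n-1)}}$. Hilbert–Poincaré series: for $k\ge 1$ let $S_k=\mathbb{F}[x_k,x_{k+1},\ldots]$, graded by weight (the monomial $x_{i_1}^{\alpha_1}\cdots x_{i_m}^{\alpha_m}$ has weight $\sum_s i_s\alpha_s$). Let $P_{k+1}$ be the ideal of $S_{k+1}$ (viewed also as generating an ideal in $S_k$) generated by all $x_a^{r-t}x_{a+1}^{t}$ with $a\ge k+1$, $0\le t\le r-1$. Let $P_{k}^{i}$ be the ideal of $S_k$ generated by $x_k^{i}$, the monomials $x_k^{i-s}x_{k+1}^{r-i+s}$ for $1\le s\le i-1$, and the generators of $P_{k+1}$. Then $\mathrm{HP}^{k}_{i}=\sum_{j\ge 0}\dim_{\mathbb{F}}\big((S_k/P_k^{i})_j\big)q^j$,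 where $(\cdot)_j$ is the weight-$j$ homogeneous component. *)

theory Defs
  imports
    "HOL-Analysis.Infinite_Products"
    "HOL-Computational_Algebra.Formal_Laurent_Series"
    "HOL-Number_Theory.Cong"
    "HOL-Library.Poly_Mapping"
    "HOL-Algebra.Embedded_Algebras"
    "HOL-Algebra.QuotRing"
begin

subsection \<open>The series A\<close>

text \<open>The infinite product is taken in the X-adic topology on formal power series.\<close>

definition A_prod :: "nat \<Rightarrow> nat \<Rightarrow> rat fps" where
  "A_prod r n = prodinf (\<lambda>m.
     if m \<ge> 1 \<and> \<not> [int m = 0] (mod int (2 * r + 1))
        \<and> \<not> [int m = int r - int n + 1] (mod int (2 * r + 1))
        \<and> \<not> [int m = - (int r - int n + 1)] (mod int (2 * r + 1))
     then 1 / (1 - fps_X ^ m) else 1)"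

text \<open>
  The recursion lives in the field of formal Laurent series, so that the division by a power of
  \<open>q\<close> is exact: on power series, \<open>f / fps_X ^ e\<close> would silently discard the
  coefficients of \<open>f\<close> below degree \<open>e\<close>.  An index \<open>N > r\<close> is written uniquely as
  \<open>N = (r - 1) * g + n\<close> with \<open>g \<ge> 1\<close> and \<open>2 \<le> n \<le> r\<close>.  The
  recursion rules in their usual form are \<open>A_initial\<close>, \<open>A_rec_1\<close> and \<open>A_rec\<close> below.
  Only \<open>r \<ge> 2\<close> and \<open>N \<ge> 1\<close> are meaningful.
\<close>

function A :: "nat \<Rightarrow> nat \<Rightarrow> rat fls" where
  "A r N =
     (if r < 2 \<or> N \<le> r then fps_to_fls (A_prod r N)
      else let g = (N - 2) div (r - 1); n = (N - 2) mod (r - 1) + 2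
           in (A r ((r - 1) * (g - 1) + (r - n + 1)) - A r ((r - 1) * (g - 1) + (r - n + 2)))
              / fls_X ^ (g * (n - 1)))"
  by pat_completeness auto

lemma A_index:
  fixes r g n :: nat
  assumes "r \<ge> 2" "2 \<le> n" "n \<le> r"
  shows "((r - 1) * g + n - 2) div (r - 1) = g" "((r - 1) * g + n - 2) mod (r - 1) + 2 = n"
proof -
  have *: "(r - 1) * g + n - 2 = (n - 2) + g * (r - 1)" "n - 2 < r - 1"
    using assms by (auto simp: mult.commute)
  show "((r - 1) * g + n - 2) div (r - 1) = g"
    unfolding *(1) using *(2) by (simp only: div_mult_self1 div_less)
  have "((r - 1) * g + n - 2) mod (r - 1) = n - 2"
    unfolding *(1) using *(2) by (simp only: mod_mult_self1 mod_less)
  then show "((r - 1) * g + n - 2) mod (r - 1) + 2 = n"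
    using assms by simp
qed

lemma A_index_ex:
  fixes r N :: nat
  assumes "r \<ge> 2" "N > r"
  obtains g n where "N = (r - 1) * Suc g + n" "2 \<le> n" "n \<le> r"
    "(N - 2) div (r - 1) = Suc g" "(N - 2) mod (r - 1) + 2 = n"
proof -
  define g n where "g = (N - 2) div (r - 1)" and "n = (N - 2) mod (r - 1) + 2"
  have N: "N = (r - 1) * g + n"
    using assms unfolding g_def n_def by simp
  have n: "2 \<le> n" "n \<le> r"
    using assms mod_less_divisor[of "r - 1" "N - 2"] unfolding n_def by linarith+
  have "g > 0"
    using N n assms by (cases g) auto
  then obtain g' where "g = Suc g'" by (cases g) auto
  with N n show ?thesis using that g_def n_def by metis
qed

termination A
proof (relation "measure snd", goal_cases)
  case 1
  then show ?case by simp
next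
  case (2 r N g n)
  then obtain g' where "N = (r - 1) * Suc g' + n" "2 \<le> n" "n \<le> r" "g = Suc g'"
    using A_index_ex[of r N] by (metis not_le)
  then show ?case by auto
next
  case (3 r N g n)
  then obtain g' where "N = (r - 1) * Suc g' + n" "2 \<le> n" "n \<le> r" "g = Suc g'"
    using A_index_ex[of r N] by (metis not_le)
  then show ?case by auto
qed

declare A.simps [simp del]

lemma A_initial: "n \<le> r \<Longrightarrow> A r n = fps_to_fls (A_prod r n)"
  by (simp add: A.simps)

text \<open>The case \<open>n = 1\<close> of the recursion only identifies two spellings of one index.\<close>

lemma A_rec_1:
  assumes "r \<ge> 2" "g \<ge> 1"
  shows "A r ((r - 1) * g + 1) = A r ((r - 1) * (g - 1) + r)"
proof -
  have "(r - 1) * g + 1 = (r - 1) * (g - 1) + r"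
    using assms by (cases g) auto
  then show ?thesis by simp
qed

lemma A_rec:
  assumes "r \<ge> 2" "g \<ge> 1" "2 \<le> n" "n \<le> r"
  shows "A r ((r - 1) * g + n) =
    (A r ((r - 1) * (g - 1) + (r - n + 1)) - A r ((r - 1) * (g - 1) + (r - n + 2)))
    / fls_X ^ (g * (n - 1))"
proof -
  have "\<not> (r < 2 \<or> (r - 1) * g + n \<le> r)"
    using assms by (cases g) auto
  then show ?thesis
    using A_index[OF assms(1,3,4), of g] by (subst A.simps) (simp only: Let_def if_False)
qed

lemma A_prod_has_prod:
  "(\<lambda>m. if m \<ge> 1 \<and> \<not> [int m = 0] (mod int (2 * r + 1))
        \<and> \<not> [int m = int r - int n + 1] (mod int (2 * r + 1))
        \<and> \<not> [int m = - (int r - int n + 1)] (mod int (2 * r + 1))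
     then 1 / (1 - fps_X ^ m) else 1) has_prod A_prod r n"
proof -
  define f :: "nat \<Rightarrow> rat fps" where
    "f = (\<lambda>m. if m \<ge> 1 \<and> \<not> [int m = 0] (mod int (2 * r + 1))
        \<and> \<not> [int m = int r - int n + 1] (mod int (2 * r + 1))
        \<and> \<not> [int m = - (int r - int n + 1)] (mod int (2 * r + 1))
     then 1 / (1 - fps_X ^ m) else 1)"
  have nth_f: "fps_nth (f m) j = (if j = 0 then 1 else 0)" if "j = 0 \<or> j < m" for m j
  proof (cases "m \<ge> 1 \<and> f m \<noteq> 1")
    case True
    then have fm: "f m = inverse (1 - fps_X ^ m)"
      by (auto simp: f_def fps_divide_unit split: if_splits)
    have "f m * (1 - fps_X ^ m) = 1"
      using True unfolding fm by (intro inverse_mult_eq_1) (auto simp: fps_X_power_nth)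
    then have "f m = 1 + fps_X ^ m * f m"
      by (simp add: algebra_simps)
    then have "fps_nth (f m) j = fps_nth (1 + fps_X ^ m * f m) j"
      by simp
    also have "\<dots> = (if j = 0 then 1 else 0)"
      using that True by (auto simp: fps_X_power_mult_nth)
    finally show ?thesis .
  next
    case False
    then have "f m = 1" by (cases "m = 0") (auto simp: f_def)
    then show ?thesis by simp
  qed
  define Q where "Q = (\<lambda>N. \<Prod>m\<le>N. f m)"
  have step: "fps_nth (Q (Suc N)) j = fps_nth (Q N) j" if "j \<le> N" for N j
  proof -
    have "fps_nth (Q (Suc N)) j = (\<Sum>k\<le>j. fps_nth (Q N) k * fps_nth (f (Suc N)) (j - k))"
      by (simp add: Q_def fps_mult_nth atLeast0AtMost)
    also have "\<dots> = (\<Sum>k\<le>j. if k = j then fps_nth (Q N) k else 0)"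
      using that by (intro sum.cong) (auto simp: nth_f)
    finally show ?thesis by simp
  qed
  have stable: "fps_nth (Q N) j = fps_nth (Q j) j" if "j \<le> N" for N j
    using that by (induction rule: dec_induct) (auto simp: step)
  define p where "p = Abs_fps (\<lambda>j. fps_nth (Q j) j)"
  have p_nth: "fps_nth (Q N) j = fps_nth p j" if "j \<le> N" for N j
    using stable[OF that] by (simp add: p_def)
  have "Q \<longlonglongrightarrow> p"
    by (intro tendsto_fpsI eventually_sequentiallyI p_nth)
  moreover have "fps_nth p 0 = 1"
    by (simp add: p_def Q_def nth_f)
  then have "p \<noteq> 0" by auto
  ultimately have "f has_prod p"
    by (auto simp: has_prod_def raw_has_prod_def Q_def)
  then show ?thesis
    using has_prod_unique[of f p] unfolding A_prod_def f_def[symmetric] by simp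
qed


subsection \<open>Graded polynomial rings and Hilbert--Poincare series\<close>

text \<open>
  Polynomials in \<open>x\<^sub>0, x\<^sub>1, \<dots>\<close>: finitely supported maps from
  monomials (finitely supported exponent vectors) to coefficients, with the convolution product.
\<close>

type_synonym 'f mpoly = "(nat \<Rightarrow>\<^sub>0 nat) \<Rightarrow>\<^sub>0 'f"

definition var :: "nat \<Rightarrow> 'f::field mpoly" where
  "var n = Poly_Mapping.single (Poly_Mapping.single n 1) 1"

definition const :: "'f::field \<Rightarrow> 'f mpoly" where
  "const c = Poly_Mapping.single 0 c"

definition weight :: "(nat \<Rightarrow>\<^sub>0 nat) \<Rightarrow> nat" where
  "weight m = (\<Sum>n\<in>Poly_Mapping.keys m. n * Poly_Mapping.lookup m n)"

text \<open>\<open>S k\<close> is the ring of polynomials in \<open>x\<^sub>k, x\<^sub>k\<^sub>+\<^sub>1, \<dots>\<close>.\<close>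

definition S :: "nat \<Rightarrow> 'f::field mpoly ring" where
  "S k = \<lparr>carrier = {p. \<forall>m\<in>Poly_Mapping.keys p. Poly_Mapping.keys m \<subseteq> {k..}},
          mult = (*), one = 1, zero = 0, add = (+)\<rparr>"

definition S_component :: "nat \<Rightarrow> nat \<Rightarrow> 'f::field mpoly set" where
  "S_component k j = {p \<in> carrier (S k). \<forall>m\<in>Poly_Mapping.keys p. weight m = j}"

definition gens_tail :: "nat \<Rightarrow> nat \<Rightarrow> 'f::field mpoly set" where
  "gens_tail r k = {var a ^ (r - t) * var (a + 1) ^ t | a t. a \<ge> k \<and> t \<le> r - 1}"

definition P :: "nat \<Rightarrow> nat \<Rightarrow> nat \<Rightarrow> 'f::field mpoly set" where
  "P r k i = Idl\<^bsub>S k\<^esub>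
     ({var k ^ i} \<union> {var k ^ (i - s) * var (k + 1) ^ (r - i + s) | s. 1 \<le> s \<and> s \<le> i - 1}
      \<union> gens_tail r (k + 1))"

lemma S_zero: "\<zero>\<^bsub>S k\<^esub> = 0" and S_one: "\<one>\<^bsub>S k\<^esub> = 1"
  and S_add: "x \<oplus>\<^bsub>S k\<^esub> y = x + y" and S_mult: "x \<otimes>\<^bsub>S k\<^esub> y = x * y"
  by (simp_all add: S_def)

lemmas S_ops = S_zero S_one S_add S_mult

lemma S_cring: "cring (S k :: 'f::field mpoly ring)"
proof -
  let ?C = "carrier (S k :: 'f mpoly ring)"
  have C: "p \<in> ?C \<longleftrightarrow> (\<forall>m\<in>Poly_Mapping.keys p. Poly_Mapping.keys m \<subseteq> {k..})" for p
    by (simp add: S_def)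
  have mult: "p * q \<in> ?C" if "p \<in> ?C" "q \<in> ?C" for p q
    unfolding C
  proof
    fix m assume "m \<in> Poly_Mapping.keys (p * q)"
    then obtain a b where "m = a + b" "a \<in> Poly_Mapping.keys p" "b \<in> Poly_Mapping.keys q"
      using keys_mult by blast
    then show "Poly_Mapping.keys m \<subseteq> {k..}"
      using that Poly_Mapping.keys_add[of a b] unfolding C by blast
  qed
  have add: "p + q \<in> ?C" if "p \<in> ?C" "q \<in> ?C" for p q
    using that Poly_Mapping.keys_add[of p q] unfolding C by blast
  have neg: "- p \<in> ?C" if "p \<in> ?C" for p
    using that unfolding C by simp
  have 01: "0 \<in> ?C" "1 \<in> ?C"
    unfolding C by auto
  show ?thesis
  proof (intro cringI abelian_groupI comm_monoidI)
    fix x assume "x \<in> ?C"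
    then show "\<exists>y\<in>?C. y \<oplus>\<^bsub>S k\<^esub> x = \<zero>\<^bsub>S k\<^esub>"
      using neg by (intro bexI[of _ "- x"]) (simp_all add: S_ops)
  qed (simp_all only: S_ops add mult 01 add_0_left mult_1_left distrib_right,
       simp_all add: ac_simps)
qed

lemma P_ideal: "ideal (P r k i :: 'f::field mpoly set) (S k)"
proof -
  interpret cring "S k :: 'f mpoly ring" by (rule S_cring)
  have pow: "var a ^ e \<in> carrier (S k :: 'f mpoly ring)" if "a \<ge> k" for a e
  proof (induction e)
    case 0
    show ?case using one_closed by (simp add: S_one)
  next
    case (Suc e)
    moreover have "var a \<in> carrier (S k :: 'f mpoly ring)"
      using that by (auto simp: S_def var_def)
    ultimately show ?case using m_closed[of "var a" "var a ^ e"] by (simp add: S_mult)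
  qed
  have mon: "var a ^ e * var b ^ d \<in> carrier (S k :: 'f mpoly ring)"
    if "a \<ge> k" "b \<ge> k" for a b e d
    using m_closed[OF pow[OF that(1), of e] pow[OF that(2), of d]] by (simp add: S_mult)
  show ?thesis
    unfolding P_def gens_tail_def by (intro genideal_ideal) (auto intro!: mon pow)
qed

text \<open>
  For an ideal \<open>I\<close> of \<open>S k\<close>, the quotient ring is an algebra over the image of the constants,
  and its homogeneous component of weight \<open>j\<close> is the image of that of \<open>S k\<close>.
\<close>

definition quot_scalars :: "nat \<Rightarrow> 'f::field mpoly set \<Rightarrow> 'f mpoly set set" where
  "quot_scalars k I = (\<lambda>c. I +>\<^bsub>S k\<^esub> const c) ` UNIV"

definition quot_component :: "nat \<Rightarrow> 'f::field mpoly set \<Rightarrow> nat \<Rightarrow> 'f mpoly set set" where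
  "quot_component k I j = (\<lambda>p. I +>\<^bsub>S k\<^esub> p) ` S_component k j"

definition HP :: "nat \<Rightarrow> 'f::field mpoly set \<Rightarrow> rat fps" where
  "HP k I = Abs_fps (\<lambda>j. of_nat
     (ring.dim (S k Quot I) (quot_scalars k I) (quot_component k I j)))"

lemma quot_scalars_subfield:
  assumes "ideal I (S k :: 'f::field mpoly ring)" "1 \<notin> I"
  shows "subfield (quot_scalars k I) (S k Quot I)"
proof -
  interpret R: cring "S k :: 'f mpoly ring" by (rule S_cring)
  interpret I: ideal I "S k" by fact
  interpret h: ring_hom_ring "S k" "S k Quot I" "(+>\<^bsub>S k\<^esub>) I" by (rule I.rcos_ring_hom_ring)
  have const: "const c \<in> carrier (S k :: 'f mpoly ring)" for c
    by (auto simp: S_def const_def)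
  have minus: "\<ominus>\<^bsub>S k\<^esub> const c = (const (- c) :: 'f mpoly)" for c
    by (rule R.minus_equality) (use const in \<open>auto simp: S_ops const_def simp flip: single_add\<close>)
  have "subring (range const) (S k :: 'f mpoly ring)"
  proof (rule R.subringI)
    show "\<one>\<^bsub>S k\<^esub> \<in> range (const :: 'f \<Rightarrow> _)"
      by (intro image_eqI[of _ _ 1]) (auto simp: S_one const_def)
  next
    fix a b :: "'f mpoly" assume "a \<in> range const" "b \<in> range const"
    then obtain c d where "a = const c" "b = const d" by auto
    then have "a \<otimes>\<^bsub>S k\<^esub> b = const (c * d)" "a \<oplus>\<^bsub>S k\<^esub> b = const (c + d)"
      by (simp_all add: S_ops const_def mult_single single_add)
    then show "a \<otimes>\<^bsub>S k\<^esub> b \<in> range const" "a \<oplus>\<^bsub>S k\<^esub> b \<in> range const"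
      by blast+
  qed (use const minus in auto)
  then have "subfield (range const) (S k :: 'f mpoly ring)"
  proof (intro R.subfieldI R.subcringI')
    show "Units (S k \<lparr>carrier := range const\<rparr>) = range const - {\<zero>\<^bsub>S k\<^esub> :: 'f mpoly}"
    proof (intro equalityI subsetI)
      fix a :: "'f mpoly" assume "a \<in> Units (S k \<lparr>carrier := range const\<rparr>)"
      then show "a \<in> range const - {\<zero>\<^bsub>S k\<^esub>}"
        by (auto simp: Units_def S_def)
    next
      fix a :: "'f mpoly" assume "a \<in> range const - {\<zero>\<^bsub>S k\<^esub>}"
      then obtain c where c: "a = const c" and "a \<noteq> 0" by (auto simp: S_zero)
      then have "c \<noteq> 0" by (auto simp: const_def)
      with c have "const (inverse c) * a = 1" "a * const (inverse c) = 1"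
        by (simp_all add: const_def mult_single)
      then show "a \<in> Units (S k \<lparr>carrier := range const\<rparr>)"
        unfolding Units_def using c by (auto simp: S_def)
    qed
  qed
  moreover have "\<one>\<^bsub>S k Quot I\<^esub> \<noteq> \<zero>\<^bsub>S k Quot I\<^esub>"
  proof
    assume "\<one>\<^bsub>S k Quot I\<^esub> = \<zero>\<^bsub>S k Quot I\<^esub>"
    then have "I +>\<^bsub>S k\<^esub> \<one>\<^bsub>S k\<^esub> = I"
      by (simp only: FactRing_def ring.simps monoid.simps)
    then have "\<one>\<^bsub>S k\<^esub> \<in> I"
      using I.a_rcos_self[OF R.one_closed] by (simp only:)
    then show False using assms(2) by (simp only: S_one)
  qed
  ultimately have "subfield ((+>\<^bsub>S k\<^esub>) I ` range const) (S k Quot I)"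
    by (rule h.img_is_subfield(2))
  then show ?thesis
    by (simp only: quot_scalars_def image_image)
qed

end

theory Submission
  imports Defs
begin

text \<open>
  A monomial lies outside \<open>P r k i\<close> iff its exponents satisfy \<open>m\<^sub>k < i\<close> and
  \<open>m\<^sub>a + m\<^sub>a\<^sub>+\<^sub>1 < r\<close> for \<open>a \<ge> k\<close>; these monomials form a basis of the quotient, and
  splitting off those with \<open>m\<^sub>k = i\<close> shows that their generating functions satisfy
  \<open>G\<^sub>k(i + 1) = G\<^sub>k(i) + q\<^sup>k\<^sup>i G\<^sub>k\<^sub>+\<^sub>1(r - i)\<close>.  This is the recursion that defines
  \<open>A\<close>, so it remains to treat \<open>J = 0\<close>, which is Gordon's generalization of the Rogers--Ramanujan
  identities.  Following Andrews, an explicit \<open>q\<close>-series satisfies the same recursion, the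
  recursion has only one solution with \<open>G\<^sub>k \<equiv> 1\<close> modulo \<open>q\<^sup>k\<close>, and at \<open>k = 1\<close> the series is a product by
  the Jacobi triple product identity.  Throughout, infinite sums and products are replaced by finite
  ones that agree up to a given order.
\<close>

subsection \<open>Congruence of power series modulo a power of the variable\<close>

definition fps_eq_upto :: "nat \<Rightarrow> 'a::field fps \<Rightarrow> 'a fps \<Rightarrow> bool" where
  "fps_eq_upto M f g \<longleftrightarrow> (\<forall>j<M. fps_nth f j = fps_nth g j)"

lemma fps_eq_upto_refl [simp]: "fps_eq_upto M f f"
  by (simp add: fps_eq_upto_def)

lemma fps_eq_upto_sym: "fps_eq_upto M f g \<Longrightarrow> fps_eq_upto M g f"
  by (simp add: fps_eq_upto_def)

lemma fps_eq_upto_trans [trans]: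
  "fps_eq_upto M f g \<Longrightarrow> fps_eq_upto M g h \<Longrightarrow> fps_eq_upto M f h"
  by (simp add: fps_eq_upto_def)

lemma fps_eq_upto_add:
  "fps_eq_upto M f g \<Longrightarrow> fps_eq_upto M f' g' \<Longrightarrow> fps_eq_upto M (f + f') (g + g')"
  by (simp add: fps_eq_upto_def)

lemma fps_eq_upto_diff:
  "fps_eq_upto M f g \<Longrightarrow> fps_eq_upto M f' g' \<Longrightarrow> fps_eq_upto M (f - f') (g - g')"
  by (simp add: fps_eq_upto_def)

lemma fps_eq_upto_mult:
  "fps_eq_upto M f g \<Longrightarrow> fps_eq_upto M f' g' \<Longrightarrow> fps_eq_upto M (f * f') (g * g')"
  by (auto simp: fps_eq_upto_def fps_mult_nth intro!: sum.cong)

lemma fps_eq_upto_sum: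
  "(\<And>x. x \<in> B \<Longrightarrow> fps_eq_upto M (f x) (g x)) \<Longrightarrow> fps_eq_upto M (sum f B) (sum g B)"
  by (induction B rule: infinite_finite_induct) (auto intro: fps_eq_upto_add)

lemma fps_eq_upto_X_power: "M \<le> e \<Longrightarrow> fps_eq_upto M (fps_X ^ e * f) 0"
  by (auto simp: fps_eq_upto_def fps_X_power_mult_nth)

lemma fps_eq_upto_one_minus_X_power: "M \<le> e \<Longrightarrow> fps_eq_upto M (1 - fps_X ^ e) 1"
  by (auto simp: fps_eq_upto_def fps_X_power_nth)

lemma fps_eq_upto_cancel:
  assumes "fps_eq_upto M (u * f) (u * g)" "fps_nth u 0 \<noteq> 0"
  shows "fps_eq_upto M f g"
proof -
  have "fps_eq_upto M (inverse u * (u * f)) (inverse u * (u * g))"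
    by (rule fps_eq_upto_mult[OF fps_eq_upto_refl assms(1)])
  then show ?thesis
    unfolding mult.assoc[symmetric] inverse_mult_eq_1[OF assms(2)] by simp
qed

lemma fps_eqI_upto: "(\<And>M. fps_eq_upto M f g) \<Longrightarrow> f = g"
  by (auto simp: fps_eq_upto_def fps_eq_iff)

text \<open>Together with the product version below, this stands in for convergence: once later
  terms vanish modulo \<open>X^M\<close>, all long enough partial sums agree to that order.\<close>

lemma fps_eq_upto_sum_lessThan:
  fixes K N :: nat
  assumes "\<And>j. K \<le> j \<Longrightarrow> fps_eq_upto M (f j) 0" "K \<le> N"
  shows "fps_eq_upto M (sum f {..<N}) (sum f {..<K})"
  using assms(2)
proof (induction N rule: dec_induct)
  case (step n)
  have "fps_eq_upto M (sum f {..<n} + f n) (sum f {..<K} + 0)"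
    using step assms(1) by (intro fps_eq_upto_add) auto
  then show ?case by simp
qed simp

lemma fps_eq_upto_prod_lessThan:
  fixes K N :: nat
  assumes "\<And>j. K \<le> j \<Longrightarrow> fps_eq_upto M (f j) 1" "K \<le> N"
  shows "fps_eq_upto M (prod f {..<N}) (prod f {..<K})"
  using assms(2)
proof (induction N rule: dec_induct)
  case (step n)
  have "fps_eq_upto M (prod f {..<n} * f n) (prod f {..<K} * 1)"
    using step assms(1) by (intro fps_eq_upto_mult) auto
  then show ?case by simp
qed simp

subsection \<open>Andrews' series\<close>

text \<open>The \<open>q\<close>-Pochhammer symbol \<open>(q^s; q)_m\<close>.\<close>

definition qpoch :: "nat \<Rightarrow> nat \<Rightarrow> 'a::field fps" where
  "qpoch s m = (\<Prod>j<m. 1 - fps_X ^ (s + j))"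

lemma qpoch_0 [simp]: "qpoch s 0 = 1"
  by (simp add: qpoch_def)

lemma qpoch_Suc: "qpoch s (Suc m) = qpoch s m * (1 - fps_X ^ (s + m))"
  by (simp add: qpoch_def)

lemma qpoch_Suc_shift: "qpoch s (Suc m) = (1 - fps_X ^ s) * qpoch (Suc s) m"
  unfolding qpoch_def by (subst prod.lessThan_Suc_shift) simp

lemma qpoch_eq_upto: "M \<le> s + K \<Longrightarrow> K \<le> N \<Longrightarrow> fps_eq_upto M (qpoch s N) (qpoch s K)"
  unfolding qpoch_def
  by (intro fps_eq_upto_prod_lessThan fps_eq_upto_one_minus_X_power) auto

lemma qpoch_nth_0: "s > 0 \<Longrightarrow> fps_nth (qpoch s m) 0 = 1"
  by (induction m) (auto simp: qpoch_Suc fps_X_power_nth)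

text \<open>
  The \<open>n\<close>-th term of Andrews' series \<open>J\<^bsub>r,i\<^esub>(x; q)\<close> at \<open>x = q\<^sup>m\<close>, multiplied by
  \<open>(q; q)\<^sub>\<infinity>\<close>.  For \<open>i \<le> r\<close> no subtraction is truncated.
\<close>

definition andrews_term :: "nat \<Rightarrow> nat \<Rightarrow> nat \<Rightarrow> nat \<Rightarrow> 'a::field fps" where
  "andrews_term r m i n =
     (-1) ^ n * fps_X ^ (r * m * n + (2 * r + 1) * (n choose 2) + (2 * r + 1 - i) * n)
       * (1 - fps_X ^ (i * (m + 2 * n + 1))) * qpoch (Suc n) m"

lemma Suc_choose_two: "Suc n choose 2 = (n choose 2) + n"
  by (simp add: numeral_2_eq_2)

text \<open>Termwise, Andrews' equation
  \<open>J_(r,i+1)(x) - J_(r,i)(x) = (x q)^i J_(r,r-i)(x q)\<close> holds up to a telescoping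
  difference. In the first two terms, the leading parts combine to a multiple of
  \<open>1 - X^n\<close>, which extends the Pochhammer symbol downwards and gives
  \<open>U n\<close>. The other parts combine to a multiple of \<open>1 - z\<close>, which extends
  it upwards and cancels against the third term except for \<open>U (Suc n)\<close>.\<close>

lemma andrews_term_rec:
  fixes m :: nat
  assumes "i < r"
  defines "U \<equiv> \<lambda>n :: nat. (-1) ^ n
      * fps_X ^ (r * m * n + (2 * r + 1) * (n choose 2) + (2 * r - i) * n) * qpoch n (Suc m) :: 'a::field fps"
  shows "andrews_term r m (Suc i) n - andrews_term r m i n
           - fps_X ^ ((m + 1) * i) * andrews_term r (m + 1) (r - i) n
         = U n - U (Suc n)"
proof -
  obtain d where r: "r = Suc (i + d)"
    using assms(1) less_iff_Suc_add by auto
  let ?X = "fps_X :: 'a fps"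
  \<comment> \<open>Up to the common factor \<open>s\<close> the claim becomes \<open>(p - v z) - (p
    y - v) - (1 - z)(v - w) = (p - p y) + (1 - z) w\<close>.\<close>
  define p y z v w s where
    "p = ?X ^ (r * m * n + (2 * r + 1) * (n choose 2) + (2 * r - i) * n)" and "y = ?X ^ n"
    and "z = ?X ^ (Suc n + m)" and "v = p * y * ?X ^ (i * (m + 2 * n + 1))"
    and "w = v * ?X ^ (Suc d * (m + 2 * n + 2))"
    and "s = (-1) ^ n * (qpoch (Suc n) m :: 'a fps)"
  note [simp] = Suc_choose_two
  have 1: "andrews_term r m (Suc i) n = s * (p - v * z)"
  proof -
    have "p * ?X ^ (Suc i * (m + 2 * n + 1)) = v * z"
      unfolding p_def v_def y_def z_def power_add[symmetric] by (simp add: algebra_simps)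
    then show ?thesis
      unfolding andrews_term_def s_def by (simp add: algebra_simps p_def)
  qed
  have 2: "andrews_term r m i n = s * (p * y - v)"
  proof -
    have "?X ^ (r * m * n + (2 * r + 1) * (n choose 2) + (2 * r + 1 - i) * n) = p * y"
      unfolding p_def y_def power_add[symmetric] r by (simp add: algebra_simps)
    then show ?thesis
      unfolding andrews_term_def s_def v_def by (simp add: right_diff_distrib mult_ac)
  qed
  have 3: "?X ^ ((m + 1) * i) * andrews_term r (m + 1) (r - i) n = s * (1 - z) * (v - w)"
  proof -
    have "?X ^ ((m + 1) * i)
        * ?X ^ (r * (m + 1) * n + (2 * r + 1) * (n choose 2) + (2 * r + 1 - (r - i)) * n) = v"
      unfolding p_def y_def v_def power_add[symmetric] r by (simp add: algebra_simps)
    moreover have "andrews_term r (m + 1) (r - i) n = (-1) ^ n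
        * ?X ^ (r * (m + 1) * n + (2 * r + 1) * (n choose 2) + (2 * r + 1 - (r - i)) * n)
        * (1 - ?X ^ (Suc d * (m + 2 * n + 2))) * (qpoch (Suc n) m * (1 - z))"
      using r by (simp add: andrews_term_def z_def qpoch_Suc)
    moreover have "a * (c * e * (1 - x) * (b * (1 - z))) = c * b * (1 - z) * (a * e - a * e * x)"
      for a b c e x :: "'a fps"
      by (simp add: algebra_simps)
    ultimately show ?thesis
      unfolding s_def w_def by (simp only:)
  qed
  have 4: "U n = s * (p - p * y)"
    unfolding U_def s_def qpoch_Suc_shift y_def p_def by (simp add: algebra_simps)
  have 5: "U (Suc n) = - (s * (1 - z) * w)"
  proof -
    have "?X ^ (r * m * Suc n + (2 * r + 1) * (Suc n choose 2) + (2 * r - i) * Suc n) = w"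
      unfolding p_def y_def v_def w_def power_add[symmetric] r by (simp add: algebra_simps)
    then show ?thesis
      unfolding U_def s_def qpoch_Suc z_def by (simp add: mult_ac)
  qed
  show ?thesis
    unfolding 1 2 3 4 5 by (simp add: algebra_simps)
qed

definition andrews_sum :: "nat \<Rightarrow> nat \<Rightarrow> nat \<Rightarrow> nat \<Rightarrow> 'a::field fps" where
  "andrews_sum r M m i = (\<Sum>n<M. andrews_term r m i n)"

lemma andrews_sum_0: "andrews_sum r M m 0 = 0"
  by (simp add: andrews_sum_def andrews_term_def)

text \<open>Summation leaves \<open>U 0 - U M\<close>. Here \<open>U 0 = 0\<close> because
  \<open>qpoch 0 (Suc m)\<close> contains the factor \<open>1 - X^0\<close>, and \<open>U M\<close>
  is divisible by \<open>X^M\<close>.\<close>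

lemma andrews_sum_rec:
  assumes "i < r"
  shows "fps_eq_upto M (andrews_sum r M m (Suc i))
    (andrews_sum r M m i + fps_X ^ ((m + 1) * i) * (andrews_sum r M (m + 1) (r - i) :: 'a::field fps))"
proof -
  define U :: "nat \<Rightarrow> 'a fps" where "U = (\<lambda>n. (-1) ^ n
      * fps_X ^ (r * m * n + (2 * r + 1) * (n choose 2) + (2 * r - i) * n) * qpoch n (Suc m))"
  have "andrews_sum r M m (Suc i) - andrews_sum r M m i
      - fps_X ^ ((m + 1) * i) * andrews_sum r M (m + 1) (r - i) = (\<Sum>n<M. U n - U (Suc n))"
    unfolding andrews_sum_def sum_distrib_left sum_subtractf[symmetric]
    using andrews_term_rec[OF assms] unfolding U_def by (intro sum.cong) auto
  also have "\<dots> = U 0 - U M"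
    by (rule sum_lessThan_telescope')
  also have "U 0 = 0"
    by (simp add: U_def qpoch_Suc_shift)
  finally have *: "andrews_sum r M m (Suc i) = andrews_sum r M m i
      + fps_X ^ ((m + 1) * i) * andrews_sum r M (m + 1) (r - i) - U M"
    by (simp add: algebra_simps)
  have "1 \<le> 2 * r - i"
    using assms by linarith
  then have "M \<le> (2 * r - i) * M"
    using mult_le_mono1[of 1 "2 * r - i" M] by simp
  then have "fps_eq_upto M (fps_X ^ (r * m * M + (2 * r + 1) * (M choose 2) + (2 * r - i) * M)
      * ((-1) ^ M * qpoch M (Suc m))) (0 :: 'a fps)"
    by (intro fps_eq_upto_X_power) linarith
  then have "fps_eq_upto M (U M) 0"
    by (simp add: U_def mult_ac)
  from fps_eq_upto_diff[OF fps_eq_upto_refl this] show ?thesis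
    by (subst *) simp
qed

text \<open>For \<open>m >= M\<close> the terms with \<open>n > 0\<close> are divisible by
  \<open>X^(r m n)\<close> and vanish modulo \<open>X^M\<close>. The term with \<open>n = 0\<close>
  reduces to \<open>qpoch 1 m\<close>, which is \<open>(q; q)_infinity\<close> to this
  order.\<close>

lemma andrews_sum_large:
  assumes "1 \<le> i" "i \<le> r" "M \<le> m"
  shows "fps_eq_upto M (andrews_sum r M m i) (qpoch 1 M :: 'a::field fps)"
proof (cases M)
  case (Suc M')
  have "fps_eq_upto M (andrews_term r m i n) (if n = 0 then qpoch 1 M else 0 :: 'a fps)" for n
  proof (cases n)
    case 0
    have "M \<le> i * (m + 1)"
      using assms mult_le_mono[of 1 i M "m + 1"] by simp
    then have "fps_eq_upto M ((1 - fps_X ^ (i * (m + 1))) * qpoch 1 m) (1 * qpoch 1 M :: 'a fps)"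
      using assms by (intro fps_eq_upto_mult fps_eq_upto_one_minus_X_power qpoch_eq_upto) auto
    with 0 show ?thesis
      by (simp add: andrews_term_def binomial_eq_0)
  next
    case (Suc k)
    have "m \<le> r * m * n"
      using assms Suc by (cases r) auto
    then have "fps_eq_upto M (fps_X ^ (r * m * n + (2 * r + 1) * (n choose 2) + (2 * r + 1 - i) * n)
      * ((-1) ^ n * (1 - fps_X ^ (i * (m + 2 * n + 1))) * qpoch (Suc n) m)) (0 :: 'a fps)"
      using assms by (intro fps_eq_upto_X_power) linarith
    with Suc show ?thesis
      by (simp add: andrews_term_def mult_ac)
  qed
  then have "fps_eq_upto M (andrews_sum r M m i) (\<Sum>n<M. if n = 0 then qpoch 1 M else 0 :: 'a fps)"
    unfolding andrews_sum_def by (intro fps_eq_upto_sum)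
  then show ?thesis
    using Suc by (simp split: if_splits)
qed (simp add: fps_eq_upto_def)

text \<open>The recursion determines its solution: modulo \<open>X\<^sup>M\<close> one descends from \<open>m = M\<close>.\<close>

lemma andrews_sum_unique:
  fixes G :: "nat \<Rightarrow> nat \<Rightarrow> 'a::field fps"
  assumes G0: "\<And>k. G k 0 = 0"
    and rec: "\<And>k i. k \<ge> 1 \<Longrightarrow> i < r \<Longrightarrow> G k (Suc i) = G k i + fps_X ^ (k * i) * G (Suc k) (r - i)"
    and low: "\<And>k i. k \<ge> 1 \<Longrightarrow> 1 \<le> i \<Longrightarrow> i \<le> r \<Longrightarrow> fps_eq_upto k (G k i) 1"
    and "m \<le> M" "i \<le> r"
  shows "fps_eq_upto M (qpoch 1 M * G (Suc m) i) (andrews_sum r M m i)"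
  using \<open>m \<le> M\<close> \<open>i \<le> r\<close>
proof (induction m arbitrary: i rule: inc_induct)
  case base
  show ?case
  proof (cases "i = 0")
    case False
    with low[of "Suc M" i] base have "fps_eq_upto M (G (Suc M) i) 1"
      by (auto simp: fps_eq_upto_def)
    then have "fps_eq_upto M (qpoch 1 M * G (Suc M) i) (qpoch 1 M * 1)"
      by (intro fps_eq_upto_mult) auto
    also have "fps_eq_upto M (qpoch 1 M * 1 :: 'a fps) (andrews_sum r M M i)"
      using andrews_sum_large[of i r M M] False base by (auto intro: fps_eq_upto_sym)
    finally show ?thesis .
  qed (simp add: G0 andrews_sum_0)
next
  case (step m)
  \<comment> \<open>At fixed \<open>m\<close> the recursion lowers \<open>i\<close>; it refers to
    level \<open>Suc m\<close> only at \<open>r - i\<close>, which the outer hypothesis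
    covers.\<close>
  from \<open>i \<le> r\<close> show ?case
  proof (induction i)
    case 0
    show ?case by (simp add: G0 andrews_sum_0)
  next
    case (Suc i)
    have "fps_eq_upto M (qpoch 1 M * G (Suc m) i
          + fps_X ^ ((m + 1) * i) * (qpoch 1 M * G (Suc (Suc m)) (r - i)))
        (andrews_sum r M m i + fps_X ^ ((m + 1) * i) * andrews_sum r M (Suc m) (r - i))"
      using Suc step by (intro fps_eq_upto_add fps_eq_upto_mult) auto
    also have "fps_eq_upto M \<dots> (andrews_sum r M m (Suc i))"
      using andrews_sum_rec[of i r M m] Suc.prems by (auto intro: fps_eq_upto_sym)
    finally show ?case
      using rec[of "Suc m" i] Suc.prems by (simp add: algebra_simps)
  qed
qed


subsection \<open>Gordon's product\<close>

text \<open>The Gaussian binomial coefficient is given by the \<open>q\<close>-Pascal rule rather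
  than as a quotient, so that no division is involved.\<close>

fun qbinomial :: "'a::comm_ring_1 \<Rightarrow> nat \<Rightarrow> nat \<Rightarrow> 'a" where
  "qbinomial q n 0 = 1"
| "qbinomial q 0 (Suc k) = 0"
| "qbinomial q (Suc n) (Suc k) = qbinomial q n k + q ^ Suc k * qbinomial q n (Suc k)"

lemma qbinomial_eq_0: "n < k \<Longrightarrow> qbinomial q n k = 0"
  by (induction q n k rule: qbinomial.induct) auto

lemma qbinomial_self: "qbinomial q n n = 1"
  by (induction n) (auto simp: qbinomial_eq_0)

text \<open>The quotient formula with denominators cleared. The hypothesis applies to both terms of
  the \<open>q\<close>-Pascal rule, and they combine through
  \<open>(1 - q^k) + q^k (1 - q^l) = 1 - q^(k+l)\<close>.\<close>

lemma qbinomial_factorial: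
  fixes q :: "'a::comm_ring_1"
  defines "F \<equiv> \<lambda>n. \<Prod>j<n. 1 - q ^ Suc j"
  shows "qbinomial q (k + l) k * F k * F l = F (k + l)"
proof (induction "k + l" arbitrary: k l)
  case (Suc n)
  have F_Suc: "F (Suc m) = F m * (1 - q ^ Suc m)" for m
    by (simp add: F_def)
  have F_0: "F 0 = 1"
    by (simp add: F_def)
  show ?case
  proof (cases k)
    case 0
    then show ?thesis by (simp add: F_0)
  next
    case (Suc k')
    note k = this
    show ?thesis
    proof (cases l)
      case 0
      then show ?thesis by (simp add: F_0 qbinomial_self)
    next
      case (Suc l')
      have n: "n = k' + l" "n = k + l'"
        using Suc.hyps(2) k Suc by auto
      have "qbinomial q (k + l) k = qbinomial q n k' + q ^ k * qbinomial q n k"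
        using k n(1) by simp
      then have "qbinomial q (k + l) k * F k * F l
          = (1 - q ^ k) * (qbinomial q n k' * F k' * F l)
            + q ^ k * (1 - q ^ l) * (qbinomial q n k * F k * F l')"
        using k Suc by (simp only: F_Suc) (simp add: algebra_simps)
      also have "\<dots> = (1 - q ^ k + q ^ k * (1 - q ^ l)) * F n"
        using Suc.hyps(1)[OF n(1)] Suc.hyps(1)[OF n(2)] n by (simp add: algebra_simps)
      also have "1 - q ^ k + q ^ k * (1 - q ^ l) = 1 - q ^ Suc n"
        using n Suc by (simp add: algebra_simps power_add)
      finally show ?thesis
        using F_Suc[of n] unfolding Suc.hyps(2) by (simp add: mult.commute)
    qed
  qed
qed (simp add: F_def)

text \<open>Splitting off the factor \<open>b + a\<close> leaves a shorter product for
  \<open>a q\<close>, and the \<open>q\<close>-Pascal rule merges the two resulting sums. The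
  variable \<open>b\<close> allows a later substitution of a power of \<open>X\<close>, by which
  power series cannot be divided freely.\<close>

theorem qbinomial_theorem:
  fixes a b q :: "'a::comm_ring_1"
  shows "(\<Prod>j<n. b + a * q ^ j) = (\<Sum>k\<le>n. qbinomial q n k * q ^ (k choose 2) * a ^ k * b ^ (n - k))"
proof (induction n arbitrary: a)
  case 0
  show ?case by (simp add: binomial_eq_0)
next
  case (Suc n)
  define T where "T = (\<lambda>k. qbinomial q n k * q ^ (k choose 2) * q ^ k * a ^ k * b ^ (n - k))"
  have "(\<Prod>j<Suc n. b + a * q ^ j) = (b + a) * (\<Prod>j<n. b + (a * q) * q ^ j)"
    by (subst prod.lessThan_Suc_shift) (simp add: mult_ac)
  also have "\<dots> = (b + a) * (\<Sum>k\<le>n. T k)"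
    unfolding Suc.IH T_def by (simp add: power_mult_distrib mult_ac)
  also have "\<dots> = (\<Sum>k\<le>n. b * T k) + (\<Sum>k\<le>n. a * T k)"
    by (simp add: distrib_right sum_distrib_left sum.distrib)
  also have "(\<Sum>k\<le>n. b * T k) = b * T 0 + (\<Sum>k<n. b * T (Suc k))"
    unfolding lessThan_Suc_atMost[symmetric] by (subst sum.lessThan_Suc_shift) simp
  \<comment> \<open>The range extends to \<open>k = n\<close> because
    \<open>qbinomial q n (Suc n)\<close> is zero; it then matches the other sum.\<close>
  also have "(\<Sum>k<n. b * T (Suc k))
      = (\<Sum>k\<le>n. q ^ Suc k * qbinomial q n (Suc k) * q ^ (Suc k choose 2) * a ^ Suc k * b ^ (n - k))"
  proof -
    have "b * T (Suc k)
        = q ^ Suc k * qbinomial q n (Suc k) * q ^ (Suc k choose 2) * a ^ Suc k * b ^ (n - k)"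
      if "k < n" for k
    proof -
      have "b ^ (n - k) = b * b ^ (n - Suc k)"
        using that by (simp flip: power_Suc add: Suc_diff_Suc)
      then show ?thesis by (simp add: T_def mult_ac)
    qed
    then show ?thesis
      by (simp add: lessThan_Suc_atMost[symmetric] qbinomial_eq_0)
  qed
  also have "b * T 0 + \<dots> + (\<Sum>k\<le>n. a * T k) = b * T 0
      + (\<Sum>k\<le>n. qbinomial q (Suc n) (Suc k) * q ^ (Suc k choose 2) * a ^ Suc k * b ^ (n - k))"
    by (simp add: T_def sum.distrib[symmetric] Suc_choose_two power_add algebra_simps)
  also have "\<dots> = (\<Sum>k\<le>Suc n. qbinomial q (Suc n) k * q ^ (k choose 2) * a ^ k * b ^ (Suc n - k))"
    unfolding lessThan_Suc_atMost[symmetric]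
    by (subst (2) sum.lessThan_Suc_shift) (simp add: T_def binomial_eq_0)
  finally show ?case .
qed

section \<open>The Jacobi triple product, first in polynomial form and then to a given order\<close>

lemma prod_lessThan_add:
  fixes f :: "nat \<Rightarrow> 'a::comm_monoid_mult"
  shows "prod f {..<n + m} = prod f {..<n} * (\<Prod>j<m. f (n + j))"
  by (induction m) (auto simp: mult.assoc)

lemma sum_lessThan_add:
  fixes f :: "nat \<Rightarrow> 'a::comm_monoid_add"
  shows "sum f {..<n + m} = sum f {..<n} + (\<Sum>j<m. f (n + j))"
  by (induction m) (auto simp: add.assoc)

lemma add_choose_two: "(a + b) choose 2 = (a choose 2) + (b choose 2) + a * b"
  by (induction b) (auto simp: Suc_choose_two binomial_eq_0)

lemma square_eq_choose_two: "a * a = 2 * (a choose 2) + a"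
  by (induction a) (auto simp: Suc_choose_two)

text \<open>
  A polynomial form of the Jacobi triple product, from the \<open>q\<close>-binomial theorem for
  \<open>\<Prod>j<2n. X\<^sup>c\<^sup>n - X\<^sup>i X\<^sup>c\<^sup>j\<close>:
  half of the factors are divisible by \<open>X\<^sup>c\<^sup>n\<close>, the others by \<open>X\<^sup>i X\<^sup>c\<^sup>j\<close>.
\<close>

lemma finite_triple_product:
  fixes c i n :: nat
  assumes "i \<le> c"
  defines "g \<equiv> qbinomial (fps_X ^ c :: 'a::field fps) (2 * n)"
  shows "(\<Prod>j<n. 1 - fps_X ^ (c * Suc j - i)) * (\<Prod>j<n. 1 - fps_X ^ (c * j + i))
    = (\<Sum>t<Suc n. g (n - t) * ((-1) ^ t * fps_X ^ (c * (t choose 2) + (c - i) * t)))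
      + (\<Sum>t<n. g (Suc n + t) * ((-1) ^ Suc t * fps_X ^ (c * (Suc t choose 2) + i * Suc t)))"
    (is "?P * ?P' = ?S + ?S'")
proof -
  let ?X = "fps_X :: 'a fps"
  \<comment> \<open>The power of \<open>X\<close> extracted from all \<open>2n\<close> factors:
    \<open>i n + c (n choose 2)\<close> from the first half, \<open>c n^2\<close> from the
    second.\<close>
  define K where "K = i * n + c * (n choose 2) + c * n * n"
  define f where "f = (\<lambda>j. ?X ^ (c * n) + (- (?X ^ i)) * (?X ^ c) ^ j)"
  define h where "h = (\<lambda>k. g k * (?X ^ c) ^ (k choose 2) * (- (?X ^ i)) ^ k * (?X ^ (c * n)) ^ (2 * n - k))"
  \<comment> \<open>For \<open>j < n\<close> the monomial \<open>X^(i + c j)\<close> divides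
    \<open>X^(c n)\<close>. Extracting it with its sign leaves \<open>1 - X^(c (n - j) - i)\<close>,
    and the index is then reversed.\<close>
  have "prod f {..<n} = (\<Prod>j<n. - (?X ^ (i + c * j)) * (1 - ?X ^ (c * Suc (n - Suc j) - i)))"
  proof (rule prod.cong)
    fix j assume "j \<in> {..<n}"
    then obtain d where n: "n = Suc (j + d)"
      using less_iff_Suc_add by auto
    have "i + c * j + (c * Suc d - i) = c * n"
      using assms(1) n by (simp add: algebra_simps)
    then have "?X ^ (i + c * j) * ?X ^ (c * Suc d - i) = ?X ^ (c * n)"
      by (simp only: power_add[symmetric])
    moreover have "?X ^ (i + c * j) = ?X ^ i * (?X ^ c) ^ j"
      by (simp only: power_add power_mult)
    moreover have "n - Suc j = d"
      using n by simp
    ultimately show "f j = - (?X ^ (i + c * j)) * (1 - ?X ^ (c * Suc (n - Suc j) - i))"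
      unfolding f_def by (simp only: right_diff_distrib) simp
  qed simp
  also have "\<dots> = (\<Prod>j<n. - (?X ^ (i + c * j))) * ?P"
    by (simp only: prod.distrib prod.nat_diff_reindex[of "\<lambda>j. 1 - ?X ^ (c * Suc j - i)" n])
  also have "(\<Prod>j<n. - (?X ^ (i + c * j))) = (-1) ^ n * ?X ^ (i * n + c * (n choose 2))"
    by (induction n) (auto simp: binomial_eq_0 Suc_choose_two algebra_simps power_add)
  finally have 1: "prod f {..<n} = (-1) ^ n * ?X ^ (i * n + c * (n choose 2)) * ?P" .
  have "f (n + j) = ?X ^ (c * n) * (1 - ?X ^ (c * j + i))" for j
    unfolding f_def by (simp add: algebra_simps power_add power_mult)
  then have 2: "(\<Prod>j<n. f (n + j)) = ?X ^ (c * n * n) * ?P'"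
    by (simp add: prod.distrib power_mult)
  have "prod f {..<n + n} = (-1) ^ n * ?X ^ K * (?P * ?P')"
    unfolding prod_lessThan_add 1 2 K_def power_add by (simp add: mult_ac)
  moreover have "prod f {..<n + n} = sum h {..<Suc n + n}"
    unfolding f_def qbinomial_theorem g_def h_def lessThan_Suc_atMost[symmetric]
    by (simp add: mult_2)
  \<comment> \<open>Summands are counted from the centre: \<open>k = n - t\<close> here and
    \<open>k = n + 1 + t\<close> in the next block. The quadratic exponents match through
    \<open>t^2 = 2 (t choose 2) + t\<close>.\<close>
  moreover have "sum h {..<Suc n} = (-1) ^ n * ?X ^ K * ?S"
  proof -
    have "sum h {..<Suc n} = (\<Sum>t<Suc n. h (Suc n - Suc t))"
      by (rule sum.nat_diff_reindex[symmetric])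
    also have "\<dots> = (\<Sum>t<Suc n. (-1) ^ n * ?X ^ K
        * (g (n - t) * ((-1) ^ t * fps_X ^ (c * (t choose 2) + (c - i) * t))))"
    proof (rule sum.cong)
      fix t assume "t \<in> {..<Suc n}"
      then obtain s where n: "n = t + s"
        using le_Suc_ex[of t n] by auto
      obtain d where c: "c = i + d"
        using assms(1) le_Suc_ex by blast
      have "c * (s choose 2) + i * s + c * n * (n + t) = K + (c * (t choose 2) + (c - i) * t)"
        unfolding K_def n add_choose_two using square_eq_choose_two[of t]
        by (simp add: algebra_simps c)
      then have "?X ^ (c * (s choose 2)) * ?X ^ (i * s) * ?X ^ (c * n * (n + t))
          = ?X ^ K * ?X ^ (c * (t choose 2) + (c - i) * t)"
        by (simp only: power_add[symmetric])
      moreover have "(-1) ^ s = (-1) ^ n * ((-1) ^ t :: 'a fps)"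
        by (simp add: n power_add flip: power_mult_distrib)
      moreover have "h (Suc n - Suc t)
          = (-1) ^ s * g (n - t) * (?X ^ (c * (s choose 2)) * ?X ^ (i * s) * ?X ^ (c * n * (n + t)))"
      proof -
        have "Suc n - Suc t = s" "n - t = s" "2 * n - s = n + t"
          using n by simp_all
        then show ?thesis
          unfolding h_def power_minus[of "?X ^ i"] by (simp only: power_mult mult_ac)
      qed
      ultimately show "h (Suc n - Suc t) = (-1) ^ n * ?X ^ K
          * (g (n - t) * ((-1) ^ t * fps_X ^ (c * (t choose 2) + (c - i) * t)))"
        by (simp add: mult_ac)
    qed simp
    finally show ?thesis by (simp only: sum_distrib_left)
  qed
  moreover have "(\<Sum>t<n. h (Suc n + t)) = (-1) ^ n * ?X ^ K * ?S'"
  proof -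
    have "h (Suc n + t) = (-1) ^ n * ?X ^ K
        * (g (Suc n + t) * ((-1) ^ Suc t * ?X ^ (c * (Suc t choose 2) + i * Suc t)))"
      if lt: "t < n" for t
    proof -
      obtain s where n: "n = Suc t + s"
        using less_imp_Suc_add[OF lt] by auto
      have "c * ((n + Suc t) choose 2) + i * (n + Suc t) + c * n * s
          = K + (c * (Suc t choose 2) + i * Suc t)"
        unfolding K_def add_choose_two[of n "Suc t"] by (simp add: algebra_simps n)
      then have "?X ^ (c * ((n + Suc t) choose 2)) * ?X ^ (i * (n + Suc t)) * ?X ^ (c * n * s)
          = ?X ^ K * ?X ^ (c * (Suc t choose 2) + i * Suc t)"
        by (simp only: power_add[symmetric])
      moreover have "2 * n - (n + Suc t) = s"
        using n by simp
      then have "h (n + Suc t) = (-1) ^ (n + Suc t) * g (n + Suc t)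
          * (?X ^ (c * ((n + Suc t) choose 2)) * ?X ^ (i * (n + Suc t)) * ?X ^ (c * n * s))"
        unfolding h_def power_minus[of "?X ^ i"] by (simp only: power_mult mult_ac)
      ultimately show ?thesis
        by (simp add: power_add mult_ac)
    qed
    then show ?thesis
      by (simp add: sum_distrib_left)
  qed
  ultimately have "(-1) ^ n * ?X ^ K * (?P * ?P') = (-1) ^ n * ?X ^ K * (?S + ?S')"
    unfolding sum_lessThan_add by (simp add: distrib_left)
  then show ?thesis
    by simp
qed

text \<open>Far from both ends the Gaussian binomial coefficient is
  \<open>1 / (q^c; q^c)_infinity\<close> to order \<open>M\<close>: all products in the factorial
  formula have at least \<open>M\<close> factors and hence agree modulo \<open>X^M\<close>.\<close>

lemma central_qbinomial_eq_upto:
  fixes c :: nat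
  defines "u \<equiv> \<lambda>n. \<Prod>j<n. 1 - fps_X ^ (c * Suc j) :: 'a::field fps"
  assumes "c > 0" "M \<le> a" "M \<le> b" "M \<le> n"
  shows "fps_eq_upto M (u n * qbinomial (fps_X ^ c) (a + b) a) 1"
proof -
  have u: "fps_eq_upto M (u m) (u M)" if "M \<le> m" for m
  proof -
    have "M \<le> c * Suc j" if "M \<le> j" for j
      using \<open>c > 0\<close> that mult_le_mono[of 1 c M "Suc j"] by simp
    then show ?thesis
      unfolding u_def using that
      by (intro fps_eq_upto_prod_lessThan fps_eq_upto_one_minus_X_power)
  qed
  have "fps_nth (u m) 0 = 1" for m
    unfolding u_def using \<open>c > 0\<close> by (induction m) (auto simp: fps_X_power_nth)
  then have u0: "fps_nth (u M) 0 \<noteq> 0"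
    by simp
  let ?g = "qbinomial (fps_X ^ c) (a + b) a :: 'a fps"
  have "fps_eq_upto M (u M * (u n * ?g)) (?g * u a * u b)"
    using fps_eq_upto_mult[OF fps_eq_upto_mult[OF fps_eq_upto_refl[of M ?g]
          u[OF assms(3)]] u[OF assms(4)]]
      fps_eq_upto_mult[OF fps_eq_upto_mult[OF fps_eq_upto_refl[of M ?g]
          fps_eq_upto_refl[of M "u M"]] u[OF assms(5)]]
    by (simp add: mult_ac fps_eq_upto_def)
  also have "?g * u a * u b = u (a + b)"
    using qbinomial_factorial[of "fps_X ^ c" a b] by (simp add: u_def power_mult[symmetric] del: power_Suc)
  also have "fps_eq_upto M \<dots> (u M * 1)"
    using u[of "a + b"] assms(3) by simp
  finally show ?thesis
    by (rule fps_eq_upto_cancel[OF _ u0])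
qed

text \<open>In the finite identity the terms with \<open>t >= M\<close> vanish modulo
  \<open>X^M\<close>, and for \<open>t < M\<close> the first product cancels the binomial
  coefficients. The two remaining terms for each \<open>t\<close> combine to a term of Andrews'
  series at \<open>m = 0\<close>.\<close>

lemma triple_product_eq_upto:
  assumes "1 \<le> i" "i \<le> r"
  defines "c \<equiv> 2 * r + 1"
  shows "fps_eq_upto M
    ((\<Prod>j<2 * M. 1 - fps_X ^ (c * Suc j)) * ((\<Prod>j<2 * M. 1 - fps_X ^ (c * Suc j - i))
      * (\<Prod>j<2 * M. 1 - fps_X ^ (c * j + i))))
    (andrews_sum r M 0 i :: 'a::field fps)"
proof -
  \<comment> \<open>This keeps \<open>n - t\<close> and \<open>Suc n + t\<close> at distance at
    least \<open>M\<close> from \<open>0\<close> and from \<open>2 * n\<close> whenever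
    \<open>t < M\<close>.\<close>
  define n where "n = 2 * M"
  define u :: "'a fps" where "u = (\<Prod>j<n. 1 - fps_X ^ (c * Suc j))"
  define g :: "nat \<Rightarrow> 'a fps" where "g = qbinomial (fps_X ^ c) (2 * n)"
  define a b :: "nat \<Rightarrow> 'a fps" where
    "a = (\<lambda>t. (-1) ^ t * fps_X ^ (c * (t choose 2) + (c - i) * t))" and
    "b = (\<lambda>t. (-1) ^ Suc t * fps_X ^ (c * (Suc t choose 2) + i * Suc t))"
  have c: "i < c" "c > 0"
    using assms by auto
  have g1: "fps_eq_upto M (u * g (n - t)) 1" "fps_eq_upto M (u * g (Suc n + t)) 1" if "t < M" for t
  proof -
    have "2 * n = (n - t) + (n + t)" "2 * n = (Suc n + t) + (n - Suc t)"
      and M: "M \<le> n - t" "M \<le> n - Suc t" "M \<le> n"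
      using that by (simp_all add: n_def)
    then show "fps_eq_upto M (u * g (n - t)) 1" "fps_eq_upto M (u * g (Suc n + t)) 1"
      using central_qbinomial_eq_upto[of c M "n - t" "n + t" n]
        central_qbinomial_eq_upto[of c M "Suc n + t" "n - Suc t" n] c M
      unfolding u_def g_def by (simp_all add: mult_2)
  qed
  have big: "fps_eq_upto M (u * (x * a t)) 0" "fps_eq_upto M (u * (x * b t)) 0" if "M \<le> t" for t x
  proof -
    have "1 * t \<le> (c - i) * t"
      using c by (intro mult_le_mono1) simp
    with that have "M \<le> c * (t choose 2) + (c - i) * t"
      by linarith
    from fps_eq_upto_X_power[OF this, of "u * x * (-1) ^ t"]
    show "fps_eq_upto M (u * (x * a t)) 0"
      by (simp add: a_def mult_ac)
    have "M \<le> c * (Suc t choose 2) + i * Suc t"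
      using that assms(1) mult_le_mono1[of 1 i "Suc t"] by simp
    from fps_eq_upto_X_power[OF this, of "u * x * (-1) ^ Suc t"]
    show "fps_eq_upto M (u * (x * b t)) 0"
      by (simp only: b_def mult_ac)
  qed
  have small: "fps_eq_upto M (u * (x * y)) y" if "fps_eq_upto M (u * x) 1" for x y
    using fps_eq_upto_mult[OF that fps_eq_upto_refl[of M y]] by (simp add: mult_ac)
  have "fps_eq_upto M (\<Sum>t<Suc n. u * (g (n - t) * a t)) (\<Sum>t<M. u * (g (n - t) * a t))"
    by (rule fps_eq_upto_sum_lessThan) (auto intro: big simp: n_def)
  also have "fps_eq_upto M \<dots> (\<Sum>t<M. a t)"
    by (rule fps_eq_upto_sum) (auto intro: small g1)
  finally have 1: "fps_eq_upto M (u * (\<Sum>t<Suc n. g (n - t) * a t)) (\<Sum>t<M. a t)"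
    by (simp only: sum_distrib_left)
  have "fps_eq_upto M (\<Sum>t<n. u * (g (Suc n + t) * b t)) (\<Sum>t<M. u * (g (Suc n + t) * b t))"
    by (rule fps_eq_upto_sum_lessThan) (auto intro: big simp: n_def)
  also have "fps_eq_upto M \<dots> (\<Sum>t<M. b t)"
    by (rule fps_eq_upto_sum) (use small g1 in auto)
  finally have 2: "fps_eq_upto M (u * (\<Sum>t<n. g (Suc n + t) * b t)) (\<Sum>t<M. b t)"
    by (simp only: sum_distrib_left)
  \<comment> \<open>The exponents differ by \<open>i (2 t + 1)\<close> and the signs are opposite,
    which produces the factor \<open>1 - X^(i (2 t + 1))\<close>.\<close>
  have "a t + b t = andrews_term r 0 i t" for t
  proof -
    have "c * (Suc t choose 2) + i * Suc t = c * (t choose 2) + (c - i) * t + i * (2 * t + 1)"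
    proof -
      obtain d where "c = i + d"
        using c(1) less_imp_add_positive by blast
      then show ?thesis
        by (simp add: Suc_choose_two algebra_simps)
    qed
    then show ?thesis
      unfolding a_def b_def andrews_term_def c_def by (simp add: power_add right_diff_distrib mult_ac)
  qed
  then have "(\<Sum>t<M. a t) + (\<Sum>t<M. b t) = andrews_sum r M 0 i"
    by (simp add: andrews_sum_def sum.distrib[symmetric])
  with fps_eq_upto_add[OF 1 2] show ?thesis
    using finite_triple_product[of i c n, where ?'a = 'a] c
    unfolding u_def g_def a_def b_def n_def by (simp only: distrib_left less_imp_le)
qed


section \<open>The product side, sorted by residue classes\<close>

lemma one_minus_X_power_mult_inverse:
  assumes "m > 0"
  shows "(1 - fps_X ^ m) * (1 / (1 - fps_X ^ m)) = (1 :: 'a::field fps)"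
proof -
  have "fps_nth (1 - fps_X ^ m :: 'a fps) 0 \<noteq> 0"
    using assms by (simp add: fps_X_power_nth)
  then show ?thesis
    using inverse_mult_eq_1[of "1 - fps_X ^ m :: 'a fps"]
    by (simp add: fps_divide_unit mult.commute)
qed

lemma residue_classes_iff:
  fixes r i m :: nat
  assumes "1 \<le> i" "i \<le> r" "l = r - i + 1"
  shows "\<not> [int m = 0] (mod int (2 * r + 1))
        \<and> \<not> [int m = int r - int l + 1] (mod int (2 * r + 1))
        \<and> \<not> [int m = - (int r - int l + 1)] (mod int (2 * r + 1))
    \<longleftrightarrow> m mod (2 * r + 1) \<notin> {0, i, 2 * r + 1 - i}"
proof -
  define c where "c = 2 * r + 1"
  have i: "i < c" "int r - int l + 1 = int i" "c - i < c"
    using assms by (auto simp: c_def)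
  have "[int m = 0] (mod int c) \<longleftrightarrow> m mod c = 0"
    using cong_int_iff[of m 0 c] by (simp add: cong_def)
  moreover have "[int m = int i] (mod int c) \<longleftrightarrow> m mod c = i"
    using cong_int_iff[of m i c] i by (simp add: cong_def)
  moreover have "[- int i = int (c - i)] (mod int c)"
    using i by (simp add: cong_iff_dvd_diff of_nat_diff)
  then have "[int m = - int i] (mod int c) \<longleftrightarrow> [int m = int (c - i)] (mod int c)"
    by (meson cong_trans cong_sym)
  then have "[int m = - int i] (mod int c) \<longleftrightarrow> m mod c = c - i"
    using cong_int_iff[of m "c - i" c] i by (simp add: cong_def)
  ultimately show ?thesis
    unfolding i(2) c_def by simp
qed

text \<open>Each block of \<open>c\<close> consecutive exponents meets each of the classes
  \<open>0\<close>, \<open>i\<close> and \<open>-i\<close> exactly once; they are distinct because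
  \<open>0 < i\<close> and \<open>2 i < c\<close>.\<close>

lemma prod_three_residue_classes:
  fixes c i n :: nat
  assumes "1 \<le> i" "2 * i < c"
  shows "(\<Prod>j<c * n. if Suc j mod c \<in> {0, i, c - i} then 1 - fps_X ^ Suc j else 1)
    = ((\<Prod>j<n. 1 - fps_X ^ (c * Suc j)) * ((\<Prod>j<n. 1 - fps_X ^ (c * Suc j - i))
      * (\<Prod>j<n. 1 - fps_X ^ (c * j + i))) :: 'a::field fps)"
proof (induction n)
  case (Suc n)
  have "(\<Prod>j<c. if Suc (c * n + j) mod c \<in> {0, i, c - i} then 1 - fps_X ^ Suc (c * n + j) else 1)
      = (\<Prod>j<c. if j \<in> {c - 1, i - 1, c - i - 1} then 1 - fps_X ^ Suc (c * n + j) else (1 :: 'a fps))"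
  proof (rule prod.cong)
    fix j assume "j \<in> {..<c}"
    have "Suc (c * n + j) mod c = Suc j mod c"
      using mod_mult_self2[of "Suc j" c n] by (simp add: ac_simps)
    also have "\<dots> = (if Suc j = c then 0 else Suc j)"
      using \<open>j \<in> {..<c}\<close> by auto
    finally have "Suc (c * n + j) mod c \<in> {0, i, c - i} \<longleftrightarrow> j \<in> {c - 1, i - 1, c - i - 1}"
      using assms \<open>j \<in> {..<c}\<close> by auto
    then show "(if Suc (c * n + j) mod c \<in> {0, i, c - i} then 1 - fps_X ^ Suc (c * n + j) else 1)
        = (if j \<in> {c - 1, i - 1, c - i - 1} then 1 - fps_X ^ Suc (c * n + j) else (1 :: 'a fps))"
      by (simp only:)
  qed simp
  also have "\<dots> = (\<Prod>j\<in>{..<c} \<inter> {c - 1, i - 1, c - i - 1}. 1 - fps_X ^ Suc (c * n + j))"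
    by (rule prod.inter_restrict[symmetric]) simp
  also have "{..<c} \<inter> {c - 1, i - 1, c - i - 1} = {c - 1, i - 1, c - i - 1}"
    using assms by auto
  also have "(\<Prod>j\<in>{c - 1, i - 1, c - i - 1}. 1 - fps_X ^ Suc (c * n + j) :: 'a fps)
      = (1 - fps_X ^ Suc (c * n + (c - 1))) * ((1 - fps_X ^ Suc (c * n + (c - i - 1)))
        * (1 - fps_X ^ Suc (c * n + (i - 1))))"
  proof -
    have "c - 1 \<noteq> i - 1" "c - 1 \<noteq> c - i - 1" "i - 1 \<noteq> c - i - 1"
      using assms by auto
    then show ?thesis
      by (simp del: power_Suc)
  qed
  also have "Suc (c * n + (c - 1)) = c * Suc n"
    using assms by simp
  also have "Suc (c * n + (c - i - 1)) = c * Suc n - i"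
    using assms by simp
  also have "Suc (c * n + (i - 1)) = c * n + i"
    using assms by simp
  finally have *: "(\<Prod>j<c. if Suc (c * n + j) mod c \<in> {0, i, c - i}
        then 1 - fps_X ^ Suc (c * n + j) else 1)
      = (1 - fps_X ^ (c * Suc n)) * ((1 - fps_X ^ (c * Suc n - i)) * (1 - fps_X ^ (c * n + i)) :: 'a fps)" .
  define F :: "nat \<Rightarrow> 'a fps" where
    "F = (\<lambda>j. if Suc j mod c \<in> {0, i, c - i} then 1 - fps_X ^ Suc j else 1)"
  have "prod F {..<c * Suc n} = prod F {..<c * n} * (\<Prod>j<c. F (c * n + j))"
    using prod_lessThan_add[of F "c * n" c] by (simp add: add.commute)
  then show ?case
    unfolding F_def * Suc.IH by (simp del: power_Suc mult_Suc_right add: mult_ac)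
qed simp

text \<open>Multiplication by \<open>(q; q)_infinity\<close> cancels every factor of the product and
  leaves those in the classes \<open>0\<close>, \<open>i\<close> and \<open>-i\<close> modulo
  \<open>2 r + 1\<close>, which form the triple product.\<close>

lemma A_prod_eq_upto:
  assumes "1 \<le> i" "i \<le> r" "l = r - i + 1"
  shows "fps_eq_upto M (qpoch 1 M * A_prod r l) (andrews_sum r M 0 i)"
proof -
  define c where "c = 2 * r + 1"
  define n where "n = 2 * M"
  define f :: "nat \<Rightarrow> rat fps" where
    "f = (\<lambda>m. if m \<ge> 1 \<and> m mod c \<notin> {0, i, c - i} then 1 / (1 - fps_X ^ m) else 1)"
  have "f has_prod A_prod r l"
    using A_prod_has_prod[of r l] unfolding residue_classes_iff[OF assms] f_def c_def .
  then have lim: "(\<lambda>N. \<Prod>k<N. f k) \<longlonglongrightarrow> A_prod r l"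
    by (rule has_prod_imp_tendsto')
  have f1: "fps_eq_upto M (f m) 1" if "M \<le> m" for m
  proof (cases "m > 0")
    case True
    have "fps_eq_upto M (1 * (1 / (1 - fps_X ^ m))) ((1 - fps_X ^ m) * (1 / (1 - fps_X ^ m)) :: rat fps)"
      using fps_eq_upto_one_minus_X_power[OF that] by (intro fps_eq_upto_mult) (auto intro: fps_eq_upto_sym)
    then show ?thesis
      using one_minus_X_power_mult_inverse[OF True, where ?'a = rat] by (simp add: f_def)
  qed (simp add: f_def)
  have "fps_eq_upto M (A_prod r l) (\<Prod>k<M. f k)"
    unfolding fps_eq_upto_def
  proof (intro allI impI)
    fix j assume "j < M"
    \<comment> \<open>Convergence in the \<open>X\<close>-adic topology makes each coefficient
      eventually constant; by \<open>f1\<close> the coefficient at \<open>j\<close> is already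
      constant from \<open>M\<close> on.\<close>
    have "eventually (\<lambda>N. fps_nth (\<Prod>k<N. f k) j = fps_nth (A_prod r l) j) sequentially"
      using lim unfolding tendsto_fps_iff by blast
    then obtain N where "M \<le> N" "fps_nth (\<Prod>k<N. f k) j = fps_nth (A_prod r l) j"
      unfolding eventually_sequentially by (meson nat_le_linear)
    then show "fps_nth (A_prod r l) j = fps_nth (\<Prod>k<M. f k) j"
      using fps_eq_upto_prod_lessThan[of M M f N] f1 \<open>j < M\<close> unfolding fps_eq_upto_def by simp
  qed
  also have "fps_eq_upto M \<dots> (\<Prod>k<Suc (c * n). f k)"
    by (rule fps_eq_upto_sym, rule fps_eq_upto_prod_lessThan) (auto intro: f1 simp: c_def n_def)
  also have "(\<Prod>k<Suc (c * n). f k) = (\<Prod>j<c * n. f (Suc j))"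
    by (subst prod.lessThan_Suc_shift) (simp add: f_def)
  finally have A: "fps_eq_upto M (A_prod r l) (\<Prod>j<c * n. f (Suc j))" .
  have "fps_eq_upto M (qpoch 1 (c * n)) (qpoch 1 M :: rat fps)"
    by (rule qpoch_eq_upto) (auto simp: c_def n_def)
  then have "fps_eq_upto M (qpoch 1 M * A_prod r l) (qpoch 1 (c * n) * (\<Prod>j<c * n. f (Suc j)))"
    using A by (intro fps_eq_upto_mult) (auto intro: fps_eq_upto_sym)
  also have "qpoch 1 (c * n) * (\<Prod>j<c * n. f (Suc j))
      = (\<Prod>j<c * n. if Suc j mod c \<in> {0, i, c - i} then 1 - fps_X ^ Suc j else 1)"
    unfolding qpoch_def prod.distrib[symmetric]
  proof (rule prod.cong)
    fix j
    show "(1 - fps_X ^ (1 + j)) * f (Suc j)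
        = (if Suc j mod c \<in> {0, i, c - i} then 1 - fps_X ^ Suc j else 1)"
      using one_minus_X_power_mult_inverse[of "Suc j", where ?'a = rat]
      by (auto simp: f_def simp del: power_Suc)
  qed simp
  also have "\<dots> = (\<Prod>j<n. 1 - fps_X ^ (c * Suc j)) * ((\<Prod>j<n. 1 - fps_X ^ (c * Suc j - i))
      * (\<Prod>j<n. 1 - fps_X ^ (c * j + i)))"
    using assms by (intro prod_three_residue_classes) (auto simp: c_def)
  also have "fps_eq_upto M \<dots> (andrews_sum r M 0 i)"
    unfolding n_def c_def by (rule triple_product_eq_upto) (use assms in auto)
  finally show ?thesis .
qed

subsection \<open>Monomial basis of the quotient\<close>

definition admissible :: "nat \<Rightarrow> nat \<Rightarrow> nat \<Rightarrow> (nat \<Rightarrow>\<^sub>0 nat) set" where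
  "admissible r k i = {m. Poly_Mapping.keys m \<subseteq> {k..} \<and> Poly_Mapping.lookup m k < i
     \<and> (\<forall>a\<ge>k. Poly_Mapping.lookup m a + Poly_Mapping.lookup m (Suc a) < r)}"

lemma le_if_lookup_pos:
  "Poly_Mapping.keys m \<subseteq> {k..} \<Longrightarrow> 0 < Poly_Mapping.lookup m a \<Longrightarrow> k \<le> (a :: nat)"
  for m :: "nat \<Rightarrow>\<^sub>0 nat"
  by (auto simp: in_keys_iff subset_iff)

text \<open>Exponents do not grow when passing to a divisor. Hence polynomials without admissible
  monomials absorb multiplication.\<close>

lemma admissible_addD:
  assumes "m + m' \<in> admissible r k i"
  shows "m' \<in> admissible r k i"
proof -
  have "Poly_Mapping.keys m' \<subseteq> Poly_Mapping.keys (m + m')"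
    by (auto simp: in_keys_iff lookup_add)
  moreover have "Poly_Mapping.lookup m' a + Poly_Mapping.lookup m' (Suc a) < r" if "k \<le> a" for a
  proof -
    have "Poly_Mapping.lookup (m + m') a + Poly_Mapping.lookup (m + m') (Suc a) < r"
      using assms that by (auto simp: admissible_def)
    then show ?thesis by (simp add: lookup_add)
  qed
  moreover have "Poly_Mapping.lookup m' k < i"
    using assms by (simp add: admissible_def lookup_add)
  ultimately show ?thesis
    using assms by (auto simp: admissible_def)
qed

lemma var_power: "var a ^ e = Poly_Mapping.single (Poly_Mapping.single a e) (1 :: 'f::field)"
  by (induction e) (simp_all add: var_def mult_single single_add[symmetric])

lemma var_power_mult:
  "var a ^ d * var b ^ e
     = Poly_Mapping.single (Poly_Mapping.single a d + Poly_Mapping.single b e) (1 :: 'f::field)"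
  by (simp add: var_power mult_single)

lemma carrier_S: "p \<in> carrier (S k) \<longleftrightarrow> (\<forall>m\<in>Poly_Mapping.keys p. Poly_Mapping.keys m \<subseteq> {k..})"
  by (simp add: S_def)

lemma sum_single_lookup:
  "p = (\<Sum>m\<in>Poly_Mapping.keys p. Poly_Mapping.single m (Poly_Mapping.lookup p m))"
  by (rule poly_mapping_eqI)
    (auto simp: lookup_sum lookup_single when_def in_keys_iff)

text \<open>The right-hand side is an ideal and each generator is a single inadmissible monomial, so
  minimality of the generated ideal applies.\<close>

lemma P_subset:
  assumes "1 \<le> i" "i \<le> r"
  shows "(P r k i :: 'f::field mpoly set)
    \<subseteq> {p \<in> carrier (S k). Poly_Mapping.keys p \<inter> admissible r k i = {}}" (is "_ \<subseteq> ?N")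
proof -
  interpret R: cring "S k :: 'f mpoly ring" by (rule S_cring)
  have mult: "x * a \<in> ?N" if "a \<in> ?N" "x \<in> carrier (S k)" for a x :: "'f mpoly"
  proof -
    have "x * a \<in> carrier (S k)"
      using R.m_closed[of x a] that by (simp add: S_mult)
    moreover have False if m: "m \<in> Poly_Mapping.keys (x * a)" "m \<in> admissible r k i" for m
    proof -
      obtain b c where "m = b + c" "c \<in> Poly_Mapping.keys a"
        using m(1) keys_mult[of x a] by blast
      then show False
        using \<open>a \<in> ?N\<close> m(2) admissible_addD by blast
    qed
    ultimately show ?thesis by blast
  qed
  have "ideal ?N (S k)"
  proof (rule idealI)
    show "ring (S k :: 'f mpoly ring)" by (rule R.ring_axioms)
  next
    show "subgroup ?N (add_monoid (S k))"
    proof (rule R.add.subgroupI)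
      show "?N \<noteq> {}"
        by (auto intro!: exI[of _ 0] simp: carrier_S)
    next
      fix a :: "'f mpoly" assume a: "a \<in> ?N"
      then have "- a \<in> carrier (S k)" by (simp add: carrier_S)
      then have "\<ominus>\<^bsub>S k\<^esub> a = - a"
        using a by (intro R.minus_equality) (auto simp: S_ops)
      then show "\<ominus>\<^bsub>S k\<^esub> a \<in> ?N"
        using a by (simp add: carrier_S)
    next
      fix a b :: "'f mpoly" assume "a \<in> ?N" "b \<in> ?N"
      then show "a \<oplus>\<^bsub>S k\<^esub> b \<in> ?N"
        using Poly_Mapping.keys_add[of a b] unfolding carrier_S S_add by blast
    qed auto
  next
    fix a x :: "'f mpoly" assume "a \<in> ?N" "x \<in> carrier (S k)"
    from mult[OF this] show "x \<otimes>\<^bsub>S k\<^esub> a \<in> ?N" "a \<otimes>\<^bsub>S k\<^esub> x \<in> ?N"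
      by (simp_all add: S_mult mult.commute)
  qed
  moreover have "var k ^ i \<in> ?N"
    by (auto simp: var_power carrier_S admissible_def)
  moreover have gen: "var a ^ d * var (a + 1) ^ e \<in> ?N" if "k \<le> a" "r \<le> d + e" for a d e
  proof -
    define u :: "nat \<Rightarrow>\<^sub>0 nat" where "u = Poly_Mapping.single a d + Poly_Mapping.single (a + 1) e"
    have "Poly_Mapping.keys u \<subseteq> {k..}"
      unfolding u_def using that(1)
      by (intro order_trans[OF Poly_Mapping.keys_add]) auto
    moreover have "Poly_Mapping.lookup u a + Poly_Mapping.lookup u (Suc a) = d + e"
      by (simp add: u_def lookup_add lookup_single)
    then have "u \<notin> admissible r k i"
      using that unfolding admissible_def by (metis (mono_tags, lifting) mem_Collect_eq not_less)
    ultimately show ?thesis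
      unfolding var_power_mult u_def[symmetric] by (simp add: carrier_S)
  qed
  moreover have "var k ^ (i - s) * var (k + 1) ^ (r - i + s) \<in> ?N" if "1 \<le> s" "s \<le> i - 1" for s
    by (rule gen) (use that assms in auto)
  moreover have "var a ^ (r - t) * var (a + 1) ^ t \<in> ?N" if "k + 1 \<le> a" "t \<le> r - 1" for a t
    by (rule gen) (use that in auto)
  ultimately show ?thesis
    unfolding P_def gens_tail_def by (intro R.genideal_minimal) (assumption | blast)+
qed

text \<open>The violated condition selects the generator: \<open>x_k^i\<close> if the exponent of
  \<open>x_k\<close> is too large, otherwise a generator in the variables of an offending adjacent
  pair.\<close>

lemma generator_below_inadmissible:
  assumes "1 \<le> i" "i \<le> r" "Poly_Mapping.keys m \<subseteq> {k..}" "m \<notin> admissible r k i"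
  obtains u where "\<And>a. Poly_Mapping.lookup u a \<le> Poly_Mapping.lookup m a"
    "(Poly_Mapping.single u 1 :: 'f::field mpoly) \<in> {var k ^ i}
       \<union> {var k ^ (i - s) * var (k + 1) ^ (r - i + s) | s. 1 \<le> s \<and> s \<le> i - 1} \<union> gens_tail r (k + 1)"
proof -
  note witness = that
  let ?l = "Poly_Mapping.lookup m"
  have tail: thesis if "k + 1 \<le> a" "t \<le> r - 1" "r - t \<le> ?l a" "t \<le> ?l (a + 1)" for a t
  proof (rule witness)
    show "(Poly_Mapping.single (Poly_Mapping.single a (r - t) + Poly_Mapping.single (a + 1) t) 1 :: 'f mpoly)
      \<in> {var k ^ i} \<union> {var k ^ (i - s) * var (k + 1) ^ (r - i + s) | s. 1 \<le> s \<and> s \<le> i - 1}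
        \<union> gens_tail r (k + 1)"
      using that(1,2) unfolding gens_tail_def by (auto simp flip: var_power_mult)
  qed (use that in \<open>auto simp: lookup_add lookup_single when_def\<close>)
  show thesis
  proof (cases "i \<le> ?l k")
    case True
    show thesis
      by (rule witness[of "Poly_Mapping.single k i"])
        (use True in \<open>auto simp: lookup_single when_def var_power\<close>)
  next
    case False
    then obtain a where a: "k \<le> a" "r \<le> ?l a + ?l (a + 1)"
      using assms(3,4) by (auto simp: admissible_def not_less)
    show thesis
    proof (cases "?l a = 0")
      case True
      \<comment> \<open>If \<open>m_a = 0\<close>, then \<open>t = r\<close> would exceed the bound
        \<open>r - 1\<close>; instead \<open>x_(a+1)^r\<close> divides the monomial.\<close>
      then show thesis
        using tail[of "a + 1" 0] a by simp
    next
      case pos: False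
      show thesis
      proof (cases "a = k")
        case False
        \<comment> \<open>The choice \<open>t = r - m_a\<close> takes as much of \<open>x_a\<close>
          as possible; if \<open>m_a >= r\<close>, truncation gives \<open>t = 0\<close>.\<close>
        then show thesis
          using tail[of a "r - ?l a"] a pos by simp
      next
        case True
        \<comment> \<open>Here \<open>0 < m_k < i\<close>, so \<open>s\<close> is in range and the
          generator is \<open>x_k^(m_k) x_(k+1)^(r - m_k)\<close>.\<close>
        let ?s = "i - ?l k"
        have s: "1 \<le> ?s" "?s \<le> i - 1" "i - ?s \<le> ?l k" "r - i + ?s \<le> ?l (k + 1)"
          using True False pos a assms by auto
        show thesis
        proof (rule witness)
          show "(Poly_Mapping.single (Poly_Mapping.single k (i - ?s)
              + Poly_Mapping.single (k + 1) (r - i + ?s)) 1 :: 'f mpoly)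
            \<in> {var k ^ i} \<union> {var k ^ (i - s) * var (k + 1) ^ (r - i + s) | s. 1 \<le> s \<and> s \<le> i - 1}
              \<union> gens_tail r (k + 1)"
            using s(1,2) unfolding var_power_mult[symmetric] by blast
        qed (use s(3,4) in \<open>auto simp: lookup_add lookup_single when_def\<close>)
      qed
    qed
  qed
qed

text \<open>The ideal is monomial: every inadmissible monomial is a multiple of a generator, and a
  polynomial is the sum of its terms.\<close>

lemma P_eq:
  assumes "1 \<le> i" "i \<le> r"
  shows "(P r k i :: 'f::field mpoly set)
    = {p \<in> carrier (S k). Poly_Mapping.keys p \<inter> admissible r k i = {}}" (is "_ = ?N")
proof (intro equalityI P_subset[OF assms] subsetI)
  interpret R: cring "S k :: 'f mpoly ring" by (rule S_cring)
  interpret I: ideal "P r k i :: 'f mpoly set" "S k" by (rule P_ideal)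
  fix p :: "'f mpoly" assume p: "p \<in> ?N"
  have single: "Poly_Mapping.single m c \<in> P r k i"
    if m: "Poly_Mapping.keys m \<subseteq> {k..}" "m \<notin> admissible r k i" for m and c :: 'f
  proof -
    let ?G = "{var k ^ i} \<union> {var k ^ (i - s) * var (k + 1) ^ (r - i + s) | s. 1 \<le> s \<and> s \<le> i - 1}
      \<union> gens_tail r (k + 1) :: 'f mpoly set"
    obtain u where u: "\<And>a. Poly_Mapping.lookup u a \<le> Poly_Mapping.lookup m a"
      "(Poly_Mapping.single u 1 :: 'f mpoly) \<in> ?G"
      using generator_below_inadmissible[OF assms m, where ?'f = 'f] by blast
    have "?G \<subseteq> carrier (S k)"
      unfolding gens_tail_def var_power_mult unfolding var_power
      by (auto simp: carrier_S in_keys_iff lookup_add lookup_single when_def split: if_splits)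
    then have "(Poly_Mapping.single u 1 :: 'f mpoly) \<in> P r k i"
      using R.genideal_self[of ?G] u(2) unfolding P_def by blast
    moreover have "Poly_Mapping.keys (m - u) \<subseteq> Poly_Mapping.keys m"
      by (auto simp: in_keys_iff lookup_minus)
    then have "Poly_Mapping.single (m - u) c \<in> carrier (S k)"
      using m(1) by (auto simp: carrier_S)
    ultimately have "Poly_Mapping.single (m - u) c * Poly_Mapping.single u 1 \<in> P r k i"
      using I.I_l_closed[of "Poly_Mapping.single u 1" "Poly_Mapping.single (m - u) c"]
      by (simp add: S_mult)
    moreover have "m - u + u = m"
      using u(1) by (intro poly_mapping_eqI) (simp add: lookup_add lookup_minus)
    ultimately show ?thesis
      by (simp add: mult_single)
  qed
  have "(\<Sum>m\<in>M. Poly_Mapping.single m (Poly_Mapping.lookup p m)) \<in> P r k i"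
    if "M \<subseteq> Poly_Mapping.keys p" for M
    using finite_subset[OF that finite_keys] that
  proof (induction M rule: finite_induct)
    case empty
    show ?case using I.additive_subgroup_axioms additive_subgroup.zero_closed[of "P r k i" "S k"]
      by (simp add: S_zero)
  next
    case (insert m M)
    then have "Poly_Mapping.single m (Poly_Mapping.lookup p m) \<in> P r k i"
      using p by (intro single) (auto simp: carrier_S)
    then show ?case
      using insert I.a_closed by (simp add: S_add)
  qed
  from this[of "Poly_Mapping.keys p"] show "p \<in> P r k i"
    by (simp only: sum_single_lookup[symmetric] subset_refl)
qed

section \<open>Weights and dimensions of the graded components\<close>

lemma weight_add: "weight (m + m') = weight m + weight m'"
  unfolding weight_def
  by (rule setsum_keys_plus_distrib[where f = "\<lambda>n e. n * e"]) (simp_all add: distrib_left)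

lemma weight_single [simp]: "weight (Poly_Mapping.single a e) = a * e"
  by (simp add: weight_def)

lemma weight_0 [simp]: "weight 0 = 0"
  by (simp add: weight_def)

lemma lookup_le_weight: "a * Poly_Mapping.lookup m a \<le> weight m"
proof (cases "a \<in> Poly_Mapping.keys m")
  case True
  then show ?thesis
    using member_le_sum[OF True, of "\<lambda>n. n * Poly_Mapping.lookup m n"] by (simp add: weight_def)
qed (simp add: in_keys_iff)

text \<open>As \<open>k >= 1\<close>, every variable has positive weight, so all indices and
  exponents that occur are bounded by \<open>j\<close>.\<close>

lemma finite_weight_eq:
  assumes "k \<ge> 1"
  shows "finite {m. Poly_Mapping.keys m \<subseteq> {k..} \<and> weight m = j}" (is "finite ?W")
proof -
  have pos: "Poly_Mapping.lookup m a \<le> j \<and> a \<le> j"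
    if m: "Poly_Mapping.keys m \<subseteq> {k..}" "weight m = j" and pos: "0 < Poly_Mapping.lookup m a" for m a
  proof -
    have "0 < a"
      using le_if_lookup_pos[OF m(1) pos] assms by simp
    then have le: "Poly_Mapping.lookup m a \<le> a * Poly_Mapping.lookup m a"
      "a \<le> a * Poly_Mapping.lookup m a"
      using pos by simp_all
    show ?thesis
      using order_trans[OF le(1) lookup_le_weight] order_trans[OF le(2) lookup_le_weight] m(2)
      by simp
  qed
  have "Poly_Mapping.lookup m \<in> {f. \<forall>x. (x \<in> {..j} \<longrightarrow> f x \<in> {..j}) \<and> (x \<notin> {..j} \<longrightarrow> f x = 0)}"
    if "m \<in> ?W" for m
  proof -
    have "(a \<in> {..j} \<longrightarrow> Poly_Mapping.lookup m a \<in> {..j}) \<and> (a \<notin> {..j} \<longrightarrow> Poly_Mapping.lookup m a = 0)" for a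
    proof (cases "Poly_Mapping.lookup m a = 0")
      case False
      then show ?thesis
        using pos[of m a] that by simp
    qed simp
    then show ?thesis
      by simp
  qed
  then have "Poly_Mapping.lookup ` ?W
      \<subseteq> {f. \<forall>x. (x \<in> {..j} \<longrightarrow> f x \<in> {..j}) \<and> (x \<notin> {..j} \<longrightarrow> f x = 0)}"
    by (rule image_subsetI)
  then have "finite (Poly_Mapping.lookup ` ?W)"
    by (rule finite_subset[OF _ finite_set_of_finite_funs]) simp_all
  then show ?thesis
    by (rule finite_imageD) (rule inj_onI, rule poly_mapping_eqI, simp)
qed

lemma finite_admissible_weight:
  "k \<ge> 1 \<Longrightarrow> finite {m \<in> admissible r k i. weight m = j}"
  by (rule finite_subset[OF _ finite_weight_eq[of k j]]) (auto simp: admissible_def)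

text \<open>The classes of admissible monomials of weight \<open>j\<close> form a basis of the
  component: they span because inadmissible terms lie in the ideal, and they are independent because
  no nonzero combination of them does.\<close>

lemma HP_P:
  assumes "k \<ge> 1" "1 \<le> i" "i \<le> r"
  shows "HP k (P r k i :: 'f::field mpoly set)
    = Abs_fps (\<lambda>j. of_nat (card {m \<in> admissible r k i. weight m = j}))"
proof -
  define I where "I = (P r k i :: 'f mpoly set)"
  interpret R: cring "S k :: 'f mpoly ring" by (rule S_cring)
  interpret I: ideal I "S k" unfolding I_def by (rule P_ideal)
  interpret Q: ring "S k Quot I" by (rule I.quotient_is_ring)
  interpret h: ring_hom_ring "S k" "S k Quot I" "(+>\<^bsub>S k\<^esub>) I" by (rule I.rcos_ring_hom_ring)
  define \<phi> where "\<phi> = (\<lambda>p. I +>\<^bsub>S k\<^esub> p)"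
  define K where "K = quot_scalars k I"
  have K_eq: "K = range (\<lambda>c. \<phi> (const c))"
    by (simp add: K_def quot_scalars_def \<phi>_def)
  define mono :: "(nat \<Rightarrow>\<^sub>0 nat) \<Rightarrow> 'f mpoly" where "mono = (\<lambda>m. Poly_Mapping.single m 1)"
  have I_eq: "I = {p \<in> carrier (S k). Poly_Mapping.keys p \<inter> admissible r k i = {}}"
    unfolding I_def by (rule P_eq) (use assms in auto)
  have \<phi>_add: "\<phi> (p + q) = \<phi> p \<oplus>\<^bsub>S k Quot I\<^esub> \<phi> q" if "p \<in> carrier (S k)" "q \<in> carrier (S k)" for p q
    using h.hom_add[OF that] by (simp add: \<phi>_def S_add)
  have \<phi>_mult: "\<phi> (p * q) = \<phi> p \<otimes>\<^bsub>S k Quot I\<^esub> \<phi> q" if "p \<in> carrier (S k)" "q \<in> carrier (S k)" for p q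
    using h.hom_mult[OF that] by (simp add: \<phi>_def S_mult)
  have \<phi>_closed: "\<phi> p \<in> carrier (S k Quot I)" if "p \<in> carrier (S k)" for p
    using h.hom_closed[OF that] by (simp add: \<phi>_def)
  have \<phi>_zero: "\<phi> 0 = \<zero>\<^bsub>S k Quot I\<^esub>"
    using h.hom_zero by (simp add: \<phi>_def S_zero)
  have \<phi>_I: "\<phi> (q + p) = \<phi> p" if "q \<in> I" "p \<in> carrier (S k)" for p q
  proof -
    have q: "q \<in> carrier (S k)" using that(1) I.a_subset by blast
    have "\<phi> q = \<phi> 0"
      using I.a_rcos_const[OF that(1)] I.a_rcos_const[OF I.zero_closed] by (simp add: \<phi>_def S_zero)
    then show ?thesis
      using \<phi>_add[OF q that(2)] \<phi>_closed[OF that(2)] by (simp add: \<phi>_zero)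
  qed
  have \<phi>_eqD: "\<exists>q\<in>I. p = q + p'" if "\<phi> p = \<phi> p'" "p \<in> carrier (S k)" for p p'
    using I.a_rcos_self[OF that(2)] that(1) unfolding \<phi>_def a_r_coset_def' by (auto simp: S_add)
  have const: "const c \<in> carrier (S k)" for c :: 'f
    by (simp add: carrier_S const_def)
  have mono: "mono m \<in> carrier (S k)" if "Poly_Mapping.keys m \<subseteq> {k..}" for m
    using that by (simp add: carrier_S mono_def)
  have const_mono: "const c * mono m = Poly_Mapping.single m c" for c m
    by (simp add: const_def mono_def mult_single)
  have supp: "p \<in> carrier (S k)"
    if "Poly_Mapping.keys p \<subseteq> A" "\<And>m. m \<in> A \<Longrightarrow> Poly_Mapping.keys m \<subseteq> {k..}" for A and p :: "'f mpoly"
    using that by (auto simp: carrier_S)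
  \<comment> \<open>Describing spans through representatives turns membership into a question about
    supports.\<close>
  have Span: "Q.Span K (map (\<lambda>m. \<phi> (mono m)) ms) = \<phi> ` {p. Poly_Mapping.keys p \<subseteq> set ms}"
    if "\<And>m. m \<in> set ms \<Longrightarrow> Poly_Mapping.keys m \<subseteq> {k..}" for ms
    using that
  proof (induction ms)
    case Nil
    have "{p :: 'f mpoly. Poly_Mapping.keys p \<subseteq> {}} = {0}" by auto
    then show ?case by (simp add: \<phi>_zero)
  next
    case (Cons m ms)
    have m: "Poly_Mapping.keys m \<subseteq> {k..}" using Cons.prems by simp
    have sc: "Poly_Mapping.single m c \<in> carrier (S k)" for c :: 'f
      using m by (simp add: carrier_S)
    have IH: "Q.Span K (map (\<lambda>m. \<phi> (mono m)) ms) = \<phi> ` {p. Poly_Mapping.keys p \<subseteq> set ms}"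
      using Cons by simp
    have comb: "\<phi> (const c) \<otimes>\<^bsub>S k Quot I\<^esub> \<phi> (mono m) \<oplus>\<^bsub>S k Quot I\<^esub> \<phi> p
        = \<phi> (Poly_Mapping.single m c + p)" if "Poly_Mapping.keys p \<subseteq> set ms" for c p
    proof -
      have "p \<in> carrier (S k)"
        using that Cons.prems by (intro supp[of _ "set ms"]) auto
      then show ?thesis
        using \<phi>_mult[OF const mono[OF m], of c] \<phi>_add[OF sc, of p c] by (simp add: const_mono)
    qed
    have "Q.Span K (map (\<lambda>m. \<phi> (mono m)) (m # ms))
        = Q.line_extension K (\<phi> (mono m)) (\<phi> ` {p. Poly_Mapping.keys p \<subseteq> set ms})"
      using IH by simp
    also have "\<dots> = {\<phi> (const c) \<otimes>\<^bsub>S k Quot I\<^esub> \<phi> (mono m) \<oplus>\<^bsub>S k Quot I\<^esub> \<phi> p | c p. Poly_Mapping.keys p \<subseteq> set ms}"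
      by (rule Set.set_eqI) (unfold Q.line_extension_mem_iff K_eq, blast)
    also have "\<dots> = {\<phi> (Poly_Mapping.single m c + p) | c p. Poly_Mapping.keys p \<subseteq> set ms}"
      using comb by blast
    also have "\<dots> = \<phi> ` {p. Poly_Mapping.keys p \<subseteq> set (m # ms)}"
    proof (intro equalityI subsetI)
      fix x assume "x \<in> {\<phi> (Poly_Mapping.single m c + p) | c p. Poly_Mapping.keys p \<subseteq> set ms}"
      then obtain c p where "x = \<phi> (Poly_Mapping.single m c + p)" "Poly_Mapping.keys p \<subseteq> set ms" by blast
      moreover from this(2) have "Poly_Mapping.keys (Poly_Mapping.single m c + p) \<subseteq> set (m # ms)"
        using Poly_Mapping.keys_add[of "Poly_Mapping.single m c" p] by (auto split: if_splits)
      ultimately show "x \<in> \<phi> ` {p. Poly_Mapping.keys p \<subseteq> set (m # ms)}" by blast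
    next
      fix x assume "x \<in> \<phi> ` {p. Poly_Mapping.keys p \<subseteq> set (m # ms)}"
      then obtain p where p: "x = \<phi> p" "Poly_Mapping.keys p \<subseteq> set (m # ms)" by blast
      let ?s = "Poly_Mapping.single m (Poly_Mapping.lookup p m)"
      have "Poly_Mapping.keys (p - ?s) \<subseteq> set ms"
        using p(2) by (auto simp: in_keys_iff lookup_minus lookup_single when_def split: if_splits)
      moreover have "x = \<phi> (?s + (p - ?s))" using p(1) by simp
      ultimately show "x \<in> {\<phi> (Poly_Mapping.single m c + p) | c p. Poly_Mapping.keys p \<subseteq> set ms}"
        by blast
    qed
    finally show ?case .
  qed
  have independent: "Q.independent K (map (\<lambda>m. \<phi> (mono m)) ms)"
    if "distinct ms" "set ms \<subseteq> admissible r k i" for ms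
    using that
  proof (induction ms)
    case (Cons m ms)
    have keys: "Poly_Mapping.keys m' \<subseteq> {k..}" if "m' \<in> set (m # ms)" for m'
      using that Cons.prems by (auto simp: admissible_def)
    have "\<phi> (mono m) \<notin> Q.Span K (map (\<lambda>m. \<phi> (mono m)) ms)"
    proof
      assume "\<phi> (mono m) \<in> Q.Span K (map (\<lambda>m. \<phi> (mono m)) ms)"
      also have "Q.Span K (map (\<lambda>m. \<phi> (mono m)) ms) = \<phi> ` {p. Poly_Mapping.keys p \<subseteq> set ms}"
        using keys by (intro Span) auto
      finally obtain p where p: "\<phi> (mono m) = \<phi> p" "Poly_Mapping.keys p \<subseteq> set ms" by blast
      obtain q where q: "q \<in> I" "mono m = q + p"
        using \<phi>_eqD[OF p(1) mono[OF keys]] by auto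
      \<comment> \<open>Since \<open>m\<close> is not in \<open>ms\<close>, its coefficient
        \<open>1\<close> must come from \<open>q\<close>, although elements of \<open>I\<close>
        contain no admissible monomial.\<close>
      have "Poly_Mapping.lookup p m = 0"
        using p(2) Cons.prems by (auto simp: in_keys_iff)
      then have "Poly_Mapping.lookup q m = 1"
        using arg_cong[OF q(2), of "\<lambda>x. Poly_Mapping.lookup x m"] by (simp add: mono_def lookup_add)
      then have "m \<in> Poly_Mapping.keys q"
        by (simp add: in_keys_iff)
      then show False
        using q(1) Cons.prems unfolding I_eq by auto
    qed
    then show ?case
      using Cons \<phi>_closed[OF mono[OF keys[of m]]] by (auto intro: Q.li_Cons)
  qed simp
  \<comment> \<open>The constant monomial is admissible, so the quotient is nonzero and its scalars
    form a field.\<close>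
  have "1 \<notin> I"
    using assms unfolding I_eq by (auto simp: admissible_def)
  then have K: "subfield K (S k Quot I)"
    unfolding K_def by (intro quot_scalars_subfield I.ideal_axioms)
  have "Q.dim K (quot_component k I j) = card {m \<in> admissible r k i. weight m = j}" for j
  proof -
    let ?B = "{m \<in> admissible r k i. weight m = j}"
    obtain ms where ms: "set ms = ?B" "distinct ms"
      using finite_distinct_list[OF finite_admissible_weight[OF assms(1)]] by blast
    have "quot_component k I j = \<phi> ` S_component k j"
      by (simp add: quot_component_def \<phi>_def)
    also have "\<dots> = \<phi> ` {p. Poly_Mapping.keys p \<subseteq> ?B}"
    proof (intro equalityI image_subsetI)
      fix p :: "'f mpoly" assume p: "p \<in> S_component k j"
      \<comment> \<open>The admissible part of \<open>p\<close>; the remainder lies in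
        \<open>I\<close>.\<close>
      define q where "q = (\<Sum>m\<in>Poly_Mapping.keys p \<inter> ?B. Poly_Mapping.single m (Poly_Mapping.lookup p m))"
      have q: "Poly_Mapping.lookup q m = (if m \<in> ?B then Poly_Mapping.lookup p m else 0)" for m
        by (auto simp: q_def lookup_sum lookup_single when_def in_keys_iff)
      have "m \<notin> admissible r k i" if "m \<in> Poly_Mapping.keys (p - q)" for m
      proof -
        have "m \<notin> ?B" "m \<in> Poly_Mapping.keys p"
          using that by (auto simp: in_keys_iff lookup_minus q split: if_splits)
        then show ?thesis
          using p by (auto simp: S_component_def)
      qed
      then have "Poly_Mapping.keys (p - q) \<inter> admissible r k i = {}"
        by blast
      moreover have "Poly_Mapping.keys (p - q) \<subseteq> Poly_Mapping.keys p" "Poly_Mapping.keys q \<subseteq> Poly_Mapping.keys p"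
        by (auto simp: in_keys_iff lookup_minus q split: if_splits)
      then have "p - q \<in> carrier (S k)" and q_carrier: "q \<in> carrier (S k)"
        using p unfolding S_component_def carrier_S by blast+
      ultimately have "p - q \<in> I" unfolding I_eq by blast
      then have "\<phi> p = \<phi> q"
        using \<phi>_I[of "p - q" q] q_carrier by simp
      moreover have "Poly_Mapping.keys q \<subseteq> ?B"
        by (auto simp: in_keys_iff q split: if_splits)
      ultimately show "\<phi> p \<in> \<phi> ` {p. Poly_Mapping.keys p \<subseteq> ?B}" by blast
    next
      fix p :: "'f mpoly" assume "p \<in> {p. Poly_Mapping.keys p \<subseteq> ?B}"
      then have "p \<in> S_component k j"
        by (auto simp: S_component_def carrier_S admissible_def)
      then show "\<phi> p \<in> \<phi> ` S_component k j" by blast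
    qed
    also have "\<dots> = Q.Span K (map (\<lambda>m. \<phi> (mono m)) ms)"
      using Span[of ms] ms(1) by (auto simp: admissible_def)
    finally have "Q.dimension (length (map (\<lambda>m. \<phi> (mono m)) ms)) K (quot_component k I j)"
      using independent[OF ms(2)] ms(1) by (intro Q.dimensionI[OF K]) auto
    then show ?thesis
      using Q.dimI[OF K] distinct_card[OF ms(2)] ms(1) by (simp add: over_def)
  qed
  then show ?thesis
    by (simp add: HP_def I_def K_def)
qed

subsection \<open>Generating functions of admissible monomials\<close>

definition admissible_gf :: "nat \<Rightarrow> nat \<Rightarrow> nat \<Rightarrow> rat fps" where
  "admissible_gf r k i = Abs_fps (\<lambda>j. of_nat (card {m \<in> admissible r k i. weight m = j}))"

lemma admissible_gf_0: "admissible_gf r k 0 = 0"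
  by (simp add: admissible_gf_def admissible_def fps_eq_iff)

text \<open>A nontrivial monomial in \<open>x_k, x_(k+1), ...\<close> has weight at least
  \<open>k\<close>. This supplies the condition \<open>low\<close> of
  \<open>andrews_sum_unique\<close>.\<close>

lemma admissible_gf_nth_less:
  assumes "1 \<le> i" "i \<le> r" "j < k"
  shows "fps_nth (admissible_gf r k i) j = fps_nth 1 j"
proof -
  have zero: "m = 0" if m: "m \<in> admissible r k i" "weight m = j" for m
  proof -
    have "a \<notin> Poly_Mapping.keys m" for a
    proof
      assume "a \<in> Poly_Mapping.keys m"
      then have "k \<le> a" "1 \<le> Poly_Mapping.lookup m a"
        using m(1) le_if_lookup_pos[of m k a] by (auto simp: admissible_def in_keys_iff)
      then have "k \<le> a * Poly_Mapping.lookup m a"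
        using mult_le_mono[of k a 1] by simp
      then show False
        using lookup_le_weight[of a m] m(2) assms(3) by simp
    qed
    then show "m = 0"
      by (intro poly_mapping_eqI) (simp add: in_keys_iff)
  qed
  have "0 \<in> admissible r k i"
    using assms by (simp add: admissible_def)
  then have "{m \<in> admissible r k i. weight m = j} = {m. m = 0 \<and> j = 0}"
    using zero by (intro Collect_cong) (metis weight_0)
  also have "\<dots> = (if j = 0 then {0} else {})"
    by auto
  finally show ?thesis
    by (simp add: admissible_gf_def)
qed

text \<open>Monomials with exponent exactly \<open>i\<close> at \<open>x_k\<close> are divided by
  \<open>x_k^i\<close>. The condition on the pair \<open>(k, k+1)\<close> becomes the bound
  \<open>r - i\<close> at \<open>x_(k+1)\<close>, and the weight drops by
  \<open>k i\<close>.\<close>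

lemma admissible_gf_rec:
  assumes "k \<ge> 1" "i < r"
  shows "admissible_gf r k (Suc i)
    = admissible_gf r k i + fps_X ^ (k * i) * admissible_gf r (Suc k) (r - i)"
proof (rule fps_ext)
  fix j
  let ?W = "\<lambda>k i j. {m \<in> admissible r k i. weight m = j}"
  let ?g = "\<lambda>m. Poly_Mapping.single k i + m"
  define T where "T = {m \<in> admissible r (Suc k) (r - i). k * i + weight m = j}"
  have "?W k (Suc i) j = ?W k i j \<union> ?g ` T"
  proof (intro equalityI subsetI)
    fix m assume m: "m \<in> ?W k (Suc i) j"
    show "m \<in> ?W k i j \<union> ?g ` T"
    proof (cases "Poly_Mapping.lookup m k = i")
      case False
      then show ?thesis using m by (auto simp: admissible_def)
    next
      case True
      define m' where "m' = m - Poly_Mapping.single k i"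
      have l: "Poly_Mapping.lookup m' a = (if a = k then 0 else Poly_Mapping.lookup m a)" for a
        using True by (auto simp: m'_def lookup_minus lookup_single when_def)
      have eq: "m = ?g m'"
        by (rule poly_mapping_eqI) (auto simp: lookup_add lookup_single when_def l True)
      have "a \<ge> Suc k" if "a \<in> Poly_Mapping.keys m'" for a
      proof -
        have "a \<noteq> k" "a \<in> Poly_Mapping.keys m"
          using that by (auto simp: in_keys_iff l split: if_splits)
        then show ?thesis using m by (auto simp: admissible_def)
      qed
      moreover have "i + Poly_Mapping.lookup m (Suc k) < r"
        using m True by (auto simp: admissible_def)
      then have "Poly_Mapping.lookup m' (Suc k) < r - i"
        by (simp add: l)
      moreover have "Poly_Mapping.lookup m' a + Poly_Mapping.lookup m' (Suc a) < r" if "Suc k \<le> a" for a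
        using m that by (auto simp: admissible_def l)
      ultimately have "m' \<in> admissible r (Suc k) (r - i)"
        by (auto simp: admissible_def)
      moreover have "k * i + weight m' = j"
        using m by (simp add: eq weight_add)
      ultimately show ?thesis
        using eq by (auto simp: T_def)
    qed
  next
    fix m assume "m \<in> ?W k i j \<union> ?g ` T"
    then show "m \<in> ?W k (Suc i) j"
    proof
      assume "m \<in> ?W k i j"
      then show ?thesis by (auto simp: admissible_def)
    next
      assume "m \<in> ?g ` T"
      then obtain m' where m': "m = ?g m'" "m' \<in> admissible r (Suc k) (r - i)" "k * i + weight m' = j"
        by (auto simp: T_def)
      have k: "Poly_Mapping.lookup m' k = 0"
        using m'(2) by (auto simp: admissible_def in_keys_iff)
      have "Poly_Mapping.keys m \<subseteq> {k..}"
      proof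
        fix a assume "a \<in> Poly_Mapping.keys m"
        then have "a = k \<or> a \<in> Poly_Mapping.keys m'"
          by (auto simp: m'(1) in_keys_iff lookup_add lookup_single when_def split: if_splits)
        then show "a \<in> {k..}"
          using m'(2) by (auto simp: admissible_def)
      qed
      moreover have "Poly_Mapping.lookup m k = i"
        by (simp add: m'(1) lookup_add k)
      moreover have "Poly_Mapping.lookup m a + Poly_Mapping.lookup m (Suc a) < r" if "k \<le> a" for a
        using m'(2) that k assms(2)
        by (cases "a = k") (auto simp: admissible_def m'(1) lookup_add lookup_single when_def)
      ultimately show ?thesis
        using m'(3) by (simp add: admissible_def m'(1) weight_add)
    qed
  qed
  moreover have "?W k i j \<inter> ?g ` T = {}"
    by (auto simp: admissible_def lookup_add)
  moreover have T: "finite T" "card T = (if j < k * i then 0 else card (?W (Suc k) (r - i) (j - k * i)))"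
  proof -
    have "T = (if j < k * i then {} else ?W (Suc k) (r - i) (j - k * i))"
      by (auto simp: T_def)
    then show "finite T" "card T = (if j < k * i then 0 else card (?W (Suc k) (r - i) (j - k * i)))"
      using finite_admissible_weight[of "Suc k"] by auto
  qed
  moreover have "card (?g ` T) = card T"
    by (intro card_image inj_onI) simp
  ultimately have "card (?W k (Suc i) j) = card (?W k i j)
      + (if j < k * i then 0 else card (?W (Suc k) (r - i) (j - k * i)))"
    using finite_admissible_weight[OF assms(1)] by (simp add: card_Un_disjoint)
  then show "fps_nth (admissible_gf r k (Suc i)) j = fps_nth (admissible_gf r k i
      + fps_X ^ (k * i) * admissible_gf r (Suc k) (r - i)) j"
    by (simp add: admissible_gf_def fps_X_power_mult_nth)
qed

text \<open>To every order, both sides times \<open>(q; q)_infinity\<close> equal Andrews' series at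
  \<open>m = 0\<close>: the product by the triple product identity, the generating function by
  uniqueness.\<close>

lemma A_prod_eq_admissible_gf:
  assumes "1 \<le> i" "i \<le> r"
  shows "A_prod r (r - i + 1) = admissible_gf r 1 i"
proof (rule fps_eqI_upto)
  fix M
  have "fps_eq_upto M (qpoch 1 M * admissible_gf r (Suc 0) i) (andrews_sum r M 0 i)"
    using assms
    by (intro andrews_sum_unique admissible_gf_0 admissible_gf_rec)
      (auto simp: fps_eq_upto_def admissible_gf_nth_less)
  then have "fps_eq_upto M (qpoch 1 M * A_prod r (r - i + 1)) (qpoch 1 M * admissible_gf r 1 i)"
    using fps_eq_upto_trans[OF A_prod_eq_upto[OF assms refl] fps_eq_upto_sym] by simp
  then show "fps_eq_upto M (A_prod r (r - i + 1)) (admissible_gf r 1 i)"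
    by (rule fps_eq_upto_cancel) (simp add: qpoch_nth_0)
qed

section \<open>Comparison with the recursion for \<open>A\<close>\<close>

text \<open>The recursion for admissible monomials presents the numerator as a multiple of
  \<open>X^e\<close>, so the division in the recursion for \<open>A\<close> is exact.\<close>

lemma fls_divide_fps_X_power_mult:
  "(fps_to_fls (f + fps_X ^ e * g) - fps_to_fls f) / fls_X ^ e = fps_to_fls (g :: 'a::field fps)"
proof -
  have "fps_to_fls (f + fps_X ^ e * g) - fps_to_fls f = fls_X ^ e * fps_to_fls g"
    by (simp add: fls_times_fps_to_fls fps_to_fls_power)
  moreover have "(fls_X :: 'a fls) ^ e \<noteq> 0"
    by (rule power_not_zero) simp
  ultimately show ?thesis
    by (simp only: nonzero_mult_div_cancel_left not_False_eq_True)
qed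

text \<open>The recursion for \<open>A\<close> is \<open>admissible_gf_rec\<close> solved for its
  last summand, with index \<open>n\<close> corresponding to the bound
  \<open>r - n + 1\<close>.\<close>

lemma A_eq_admissible_gf:
  assumes "r \<ge> 2" "1 \<le> i" "i \<le> r"
  shows "A r ((r - 1) * J + (r - i + 1)) = fps_to_fls (admissible_gf r (Suc J) i)"
  using assms(2,3)
proof (induction J arbitrary: i)
  case 0
  then show ?case
    using A_prod_eq_admissible_gf[of i r] by (simp add: A_initial)
next
  case (Suc J)
  show ?case
  proof (cases "i = r")
    case True
    \<comment> \<open>For \<open>i = r\<close> the index is \<open>n = 1\<close>, where
      \<open>A\<close> only respells it. Correspondingly, \<open>admissible_gf_rec\<close> at
      exponent \<open>0\<close> identifies bound \<open>1\<close> at \<open>Suc J\<close> with bound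
      \<open>r\<close> at the next level.\<close>
    have "A r ((r - 1) * Suc J + (r - i + 1)) = A r ((r - 1) * J + (r - 1 + 1))"
      using A_rec_1[of r "Suc J"] assms(1) True by simp
    also have "\<dots> = fps_to_fls (admissible_gf r (Suc J) (Suc 0))"
      using Suc.IH[of 1] assms(1) by simp
    also have "admissible_gf r (Suc J) (Suc 0) = admissible_gf r (Suc (Suc J)) i"
      using admissible_gf_rec[of "Suc J" 0 r] assms(1) True by (simp add: admissible_gf_0)
    finally show ?thesis .
  next
    case False
    define n where "n = r - i + 1"
    have n: "2 \<le> n" "n \<le> r" "r - n + 1 = i" "r - (n - 1) + 1 = r - n + 2" "Suc (n - 1) = n"
      "r - (n - 1) = i" "n - 1 < r"
      using False Suc.prems assms(1) by (auto simp: n_def)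
    \<comment> \<open>By the hypothesis for \<open>J\<close> the numerator is the difference of the
      generating functions with the consecutive bounds \<open>n\<close> and
      \<open>n - 1\<close>.\<close>
    have "A r ((r - 1) * Suc J + n) =
        (A r ((r - 1) * J + (r - n + 1)) - A r ((r - 1) * J + (r - n + 2)))
          / fls_X ^ (Suc J * (n - 1))"
      by (rule A_rec[OF assms(1) _ n(1,2), of "Suc J", unfolded diff_Suc_1]) simp
    also have "A r ((r - 1) * J + (r - n + 1)) = fps_to_fls (admissible_gf r (Suc J) n)"
      by (rule Suc.IH) (use n in auto)
    also have "A r ((r - 1) * J + (r - n + 2)) = fps_to_fls (admissible_gf r (Suc J) (n - 1))"
      by (subst n(4)[symmetric], rule Suc.IH) (use n in auto)
    also have "admissible_gf r (Suc J) n = admissible_gf r (Suc J) (n - 1)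
        + fps_X ^ (Suc J * (n - 1)) * admissible_gf r (Suc (Suc J)) i"
      using admissible_gf_rec[of "Suc J" "n - 1" r] n by (simp only: le_add1 Suc_eq_plus1_left)
    finally show ?thesis
      unfolding n_def[symmetric] fls_divide_fps_X_power_mult .
  qed
qed

theorem theorem2p5:
  fixes r i J l :: nat
  assumes "r \<ge> 2" and "1 \<le> i" and "i \<le> r" and "l = r - i + 1"
  shows "A r ((r - 1) * J + l) =
    fps_to_fls (HP (J + 1) (P r (J + 1) i :: 'f::field_char_0 mpoly set))"
  using A_eq_admissible_gf[OF assms(1-3), of J] HP_P[of "J + 1" i r, where ?'f = 'f] assms
  by (simp add: admissible_gf_def)

end
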